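(* Let $P$ be a definite variational path geometry on a contact manifold $M^3$ and $(\sigma,\theta_0,\theta_1,\theta_2,\theta_3)$ a canonical coframe on $P$. Then $g=\sigma^2+(\theta_1)^2$ gives a well-defined metric on the contact planes of $M$ if and only if $W_2$ is identically zero on $P$.
   Context: Everything is smooth and local. A Pfaffian system is a subbundle of the cotangent bundle; $\{\alpha_1,\dots,\alpha_k\}$ denotes the span of the given 1-forms. The first derived system $\mathcal{S}'$ of $\mathcal{S}$ consists of those $\alpha\in\mathcal{S}$ with $d\alpha\equiv0$ modulo the ideal generated by $\mathcal{S}$. The retracting space (Cartan system) of $\mathcal{S}$ is the annihilator of its Cauchy characteristic vectors (vectors $v$ annihilated by $\mathcal{S}$ with $v\lrcorner d\alpha\in\mathcal{S}$ for all $\alpha\in\mathcal{S}$). $L^\perp$ is the annihilator of $L$. Contact path geometry: Let $M^3$ be a contact manifold, $\rho:P\to M$ a fibration with two-dimensional fibres (so $\dim P=5$), and $L$ a line field on $P$ transverse to the fibres of $\rho$. Let $\mathcal{I}$ be the Pfaffian system on $P$ annihilating $L$ and the fibres of $\rho$, and $\mathcal{J}$ the intersection of the retracting space of $\mathcal{I}$ with $L^\perp$. Then $(P,L,\rho)$ is a contact path geometry on $M$ if (i) $\rho_*(v)$ is tangent to a contact plane for any $v\in L$; (ii) $\mathcal{I}'$ is one-dimensional at each point; (iii) $\mathcal{J}'=\mathcal{I}$ at each point. 0-adapted coframes: local coframes $(\sigma,\theta_0,\theta_1,\theta_2,\theta_3)$ on $P$ such that $v\in TP$ projects to a contact direction iff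 $\theta_0(v)=0$; $\mathcal{I}=\{\theta_0,\theta_1\}$; $\mathcal{J}=\{\theta_0,\theta_1,\theta_2\}$; $L^\perp=\{\theta_0,\theta_1,\theta_2,\theta_3\}$; and $d\theta_i\equiv\sigma\wedge\theta_{i+1}$ mod $\theta_0,\dots,\theta_i$ for $0\le i\le 2$. They are the sections of a principal bundle $B_0\to P$. Canonical structure $B_1$ (a known theorem of Fels): there is a canonical sub-bundle $B_1\subset B_0$ with three-dimensional structure group $G_1$ consisting of the matrices (acting on the column $(\sigma,\theta_0,\theta_1,\theta_2,\theta_3)^T$) $$\mathrm{diag}(a,b,a^{-1}b,a^{-2}b,a^{-3}b)\cdot\exp\begin{pmatrix}0&0&0&0&0\\0&0&0&0&0\\0&c&0&0&0\\0&0&\tfrac43c&0&0\\0&0&0&c&0\end{pmatrix},$$ on which there is a unique equivariant connection, with connection 1-forms $\alpha,\beta,\gamma$, satisfying $$\begin{aligned} d\sigma&=\alpha\wedge\sigma+\theta_0\wedge(T_1\theta_1+T_2\theta_2+T_3\theta_3)+\theta_1\wedge(T_4\theta_2+T_5\theta_3)\\ d\theta_0&=\beta\wedge\theta_0+\sigma\wedge\theta_1\\ d\theta_1&=(\beta-\alpha)\wedge\theta_1+\gamma\wedge\theta_0+\sigma\wedge\theta_2\\ d\theta_2&=(\beta-2\alpha)\wedge\theta_2+\tfrac43\gamma\wedge\theta_1+\sigma\wedge\theta_3\\ d\theta_3&=(\beta-3\alpha)\wedge\theta_3+\gamma\wedge\theta_2+\sigma\wedge(I_0\theta_0+I_1\theta_1)+T_6\theta_0\wedge\theta_1+T_7\theta_0\wedge\theta_2+T_8\theta_1\wedge\theta_2,\end{aligned}$$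 where $\sigma,\theta_0,\dots,\theta_3$ denote the tautological 1-forms on $B_1$ and $I_0,I_1,T_1,\dots,T_8$ are functions on $B_1$ (torsion components). The path geometry is called variational if $I_1,T_5,T_8$ vanish identically on $B_1$; a variational path geometry is called definite if $T_4$ is negative everywhere. In the variational case $3\alpha-2\beta$ is closed and $T_3=-\tfrac35T_4$. For a definite variational path geometry, let $B_2\subset B_1$ be the sub-bundle on which $T_2=0$ and $T_4=-1$. On $B_2$ there are smooth functions $W_0,W_1,W_2,G_0,G_1,G_2,G_3,H$ with $$\beta=2\alpha+W_0\theta_0+W_1\theta_1+W_2\theta_2,\qquad \gamma=H\sigma-3(G_0\theta_0+G_1\theta_1+G_2\theta_2+G_3\theta_3).$$ The group $\mathbb{R}^*$ acts on sections of $B_2$ by $(\sigma,\theta_0,\theta_1,\theta_2,\theta_3)\mapsto(\lambda\sigma,\lambda^2\theta_0,\lambda\theta_1,\theta_2,\lambda^{-1}\theta_3)$, and $W_2$ is invariant under this action. A canonical coframe on $P$ (canonical section of $B_2$) is a section of $B_2$ along which $3\alpha-2\beta=0$; forms and functions on $B_2$ are pulled back to $P$ by it. "$g$ gives a well-defined metric on the contact planes of $M$" means that $g$, restricted to the vectors annihilated by $\theta_0$ (i.e. taken modulo $\theta_0$), is the pullback under $\rho$ of a metric on the contact planes of $M$.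
   Formalization: The fibres of the fibration ρ: P → M are assumed connected; otherwise, when W_2 = 0, the canonical coframe could be rescaled by different constants on different components of a fibre, and g would not descend to M. *)

theory Defs
  imports "HOL-Analysis.Analysis"
begin

text \<open>
  Everything is local: the manifolds are open subsets of Euclidean spaces, with tangent
  space the ambient space at each point.  A covector \<open>\<Sum>i. a\<^sub>i dx\<^sub>i\<close> is represented by its
  coefficient vector \<open>a\<close> and evaluated on a tangent vector \<open>v\<close> as \<open>a \<bullet> v\<close>; no metric
  meaning is attached to this pairing.  A 1-form is a vector-valued function, and a
  2-covector is a function of two tangent vectors.
\<close>

section \<open>Smooth maps and exterior calculus\<close>

primrec Ck_on :: "nat \<Rightarrow> 'a::real_normed_vector set \<Rightarrow> ('a \<Rightarrow> 'b::real_normed_vector) \<Rightarrow> bool" where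
  "Ck_on 0 U f \<longleftrightarrow> continuous_on U f"
| "Ck_on (Suc k) U f \<longleftrightarrow>
     (\<forall>x\<in>U. f differentiable (at x)) \<and> (\<forall>v. Ck_on k U (\<lambda>x. frechet_derivative f (at x) v))"

text \<open>Only used for open \<open>U\<close>.\<close>

definition smooth_on :: "'a::real_normed_vector set \<Rightarrow> ('a \<Rightarrow> 'b::real_normed_vector) \<Rightarrow> bool" where
  "smooth_on U f \<longleftrightarrow> (\<forall>k. Ck_on k U f)"

abbreviation tmap :: "('a::real_normed_vector \<Rightarrow> 'b::real_normed_vector) \<Rightarrow> 'a \<Rightarrow> 'a \<Rightarrow> 'b" where
  "tmap f x \<equiv> frechet_derivative f (at x)"

definition wedge :: "'a::real_inner \<Rightarrow> 'a \<Rightarrow> 'a \<Rightarrow> 'a \<Rightarrow> real" where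
  "wedge \<xi> \<eta> u v = (\<xi> \<bullet> u) * (\<eta> \<bullet> v) - (\<xi> \<bullet> v) * (\<eta> \<bullet> u)"

text \<open>\<open>d\<omega>(u,v) = u(\<omega>(v)) - v(\<omega>(u))\<close> for constant vector fields \<open>u\<close>, \<open>v\<close>.\<close>

definition ext_d :: "('a::real_inner \<Rightarrow> 'a) \<Rightarrow> 'a \<Rightarrow> 'a \<Rightarrow> 'a \<Rightarrow> real" where
  "ext_d \<omega> x u v = tmap \<omega> x u \<bullet> v - tmap \<omega> x v \<bullet> u"

definition pullback ::
  "('a::euclidean_space \<Rightarrow> 'b::euclidean_space) \<Rightarrow> ('b \<Rightarrow> 'b) \<Rightarrow> 'a \<Rightarrow> 'a" where
  "pullback f \<omega> x = adjoint (tmap f x) (\<omega> (f x))"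

text \<open>The degree-two part of the algebraic ideal generated by a set of covectors.\<close>

definition ideal2 :: "'a::real_inner set \<Rightarrow> ('a \<Rightarrow> 'a \<Rightarrow> real) set" where
  "ideal2 S = {\<Omega>. \<exists>n a b. (\<forall>i<n. b i \<in> S) \<and>
                 \<Omega> = (\<lambda>u v. \<Sum>i<(n::nat). wedge (a i) (b i) u v)}"

text \<open>Used both for covectors annihilating vectors and for vectors annihilated by covectors.\<close>

definition annihilator :: "'a::real_inner set \<Rightarrow> 'a set" where
  "annihilator S = {\<xi>. \<forall>v\<in>S. \<xi> \<bullet> v = 0}"

section \<open>Pfaffian systems\<close>

definition pfaff_section :: "'a::euclidean_space set \<Rightarrow> ('a \<Rightarrow> 'a set) \<Rightarrow> 'a set \<Rightarrow> ('a \<Rightarrow> 'a) \<Rightarrow> bool" where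
  "pfaff_section P S U \<omega> \<longleftrightarrow> open U \<and> U \<subseteq> P \<and> smooth_on U \<omega> \<and> (\<forall>x\<in>U. \<omega> x \<in> S x)"

text \<open>
  For sections \<open>\<omega>\<close> of \<open>S\<close>, the class of \<open>d\<omega>\<close> at \<open>x\<close> modulo \<open>S\<close> depends only on \<open>\<omega> x\<close>, so
  the derived system is defined pointwise.
\<close>

definition derived_system :: "'a::euclidean_space set \<Rightarrow> ('a \<Rightarrow> 'a set) \<Rightarrow> 'a \<Rightarrow> 'a set" where
  "derived_system P S x =
     {\<omega> x |U \<omega>. x \<in> U \<and> pfaff_section P S U \<omega> \<and> ext_d \<omega> x \<in> ideal2 (S x)}"

definition cauchy_char :: "'a::euclidean_space set \<Rightarrow> ('a \<Rightarrow> 'a set) \<Rightarrow> 'a \<Rightarrow> 'a set" where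
  "cauchy_char P S x =
     {v \<in> annihilator (S x). \<forall>U \<omega>. x \<in> U \<and> pfaff_section P S U \<omega> \<longrightarrow>
        (\<exists>\<xi>\<in>S x. \<forall>w. ext_d \<omega> x v w = \<xi> \<bullet> w)}"

definition retracting_space :: "'a::euclidean_space set \<Rightarrow> ('a \<Rightarrow> 'a set) \<Rightarrow> 'a \<Rightarrow> 'a set" where
  "retracting_space P S x = annihilator (cauchy_char P S x)"

section \<open>Contact path geometries\<close>

definition contact_structure :: "(real^3) set \<Rightarrow> (real^3 \<Rightarrow> (real^3) set) \<Rightarrow> bool" where
  "contact_structure M D \<longleftrightarrow> open M \<and>
     (\<forall>q\<in>M. \<exists>U \<eta>. open U \<and> q \<in> U \<and> U \<subseteq> M \<and> smooth_on U \<eta> \<and>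
        (\<forall>y\<in>U. D y = {w. \<eta> y \<bullet> w = 0} \<and>
           (\<exists>u v w. (\<eta> y \<bullet> u) * ext_d \<eta> y v w + (\<eta> y \<bullet> v) * ext_d \<eta> y w u
                     + (\<eta> y \<bullet> w) * ext_d \<eta> y u v \<noteq> 0)))"

text \<open>
  A local fibration: a surjective submersion with connected fibres.  The fibres are
  two-dimensional because of the types.  Connectedness is part of the local point of view;
  on disconnected fibres, data can be locally constant along the fibres without descending.
\<close>

definition fibration :: "(real^5) set \<Rightarrow> (real^3) set \<Rightarrow> (real^5 \<Rightarrow> real^3) \<Rightarrow> bool" where
  "fibration P M \<rho> \<longleftrightarrow> open P \<and> smooth_on P \<rho> \<and> \<rho> ` P = M \<and>
     (\<forall>p\<in>P. surj (tmap \<rho> p)) \<and> (\<forall>q\<in>M. connected {p \<in> P. \<rho> p = q})"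

definition fibre_tangent :: "(real^5 \<Rightarrow> real^3) \<Rightarrow> real^5 \<Rightarrow> (real^5) set" where
  "fibre_tangent \<rho> p = {v. tmap \<rho> p v = 0}"

definition line_field :: "'a::euclidean_space set \<Rightarrow> ('a \<Rightarrow> 'a set) \<Rightarrow> bool" where
  "line_field P L \<longleftrightarrow> (\<forall>p\<in>P. \<exists>U X. open U \<and> p \<in> U \<and> U \<subseteq> P \<and> smooth_on U X \<and>
     (\<forall>y\<in>U. X y \<noteq> 0 \<and> L y = span {X y}))"

definition sysI :: "(real^5 \<Rightarrow> real^3) \<Rightarrow> (real^5 \<Rightarrow> (real^5) set) \<Rightarrow> real^5 \<Rightarrow> (real^5) set" where
  "sysI \<rho> L p = annihilator (L p \<union> fibre_tangent \<rho> p)"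

definition sysJ :: "(real^5) set \<Rightarrow> (real^5 \<Rightarrow> real^3) \<Rightarrow> (real^5 \<Rightarrow> (real^5) set) \<Rightarrow> real^5 \<Rightarrow> (real^5) set" where
  "sysJ P \<rho> L p = retracting_space P (sysI \<rho> L) p \<inter> annihilator (L p)"

definition contact_path_geometry ::
  "(real^5) set \<Rightarrow> (real^3) set \<Rightarrow> (real^3 \<Rightarrow> (real^3) set) \<Rightarrow> (real^5 \<Rightarrow> real^3) \<Rightarrow>
   (real^5 \<Rightarrow> (real^5) set) \<Rightarrow> bool" where
  "contact_path_geometry P M D \<rho> L \<longleftrightarrow>
     contact_structure M D \<and> fibration P M \<rho> \<and> line_field P L \<and>
     (\<forall>p\<in>P. L p \<inter> fibre_tangent \<rho> p = {0}) \<and>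
     (\<forall>p\<in>P. \<forall>v\<in>L p. tmap \<rho> p v \<in> D (\<rho> p)) \<and>
     (\<forall>p\<in>P. dim (derived_system P (sysI \<rho> L) p) = 1) \<and>
     (\<forall>p\<in>P. derived_system P (sysJ P \<rho> L) p = sysI \<rho> L p)"

section \<open>Adapted coframes\<close>

text \<open>
  A coframe at a point is an invertible matrix whose rows are \<open>\<sigma>, \<theta>\<^sub>0, \<theta>\<^sub>1, \<theta>\<^sub>2, \<theta>\<^sub>3\<close>, so that
  the structure groups act by matrix multiplication from the left.  The coframe bundle
  of \<open>P\<close> is the set of all \<open>(p, u)\<close> with \<open>p \<in> P\<close> and \<open>u\<close> invertible.
\<close>

type_synonym cfb = "(real^5) \<times> (real^5^5)"

definition sigma :: "real^5^5 \<Rightarrow> real^5" where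
  "sigma u = u $ 1"

definition theta :: "nat \<Rightarrow> real^5^5 \<Rightarrow> real^5" where
  "theta i u = u $ of_nat (i + 2)"

definition zero_adapted ::
  "(real^5) set \<Rightarrow> (real^3 \<Rightarrow> (real^3) set) \<Rightarrow> (real^5 \<Rightarrow> real^3) \<Rightarrow> (real^5 \<Rightarrow> (real^5) set) \<Rightarrow>
   (real^5) set \<Rightarrow> (real^5 \<Rightarrow> real^5^5) \<Rightarrow> bool" where
  "zero_adapted P D \<rho> L U s \<longleftrightarrow> open U \<and> U \<subseteq> P \<and> smooth_on U s \<and>
     (\<forall>p\<in>U. invertible (s p) \<and>
        (\<forall>v. tmap \<rho> p v \<in> D (\<rho> p) \<longleftrightarrow> theta 0 (s p) \<bullet> v = 0) \<and>
        sysI \<rho> L p = span {theta 0 (s p), theta 1 (s p)} \<and>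
        sysJ P \<rho> L p = span {theta 0 (s p), theta 1 (s p), theta 2 (s p)} \<and>
        annihilator (L p) = span {theta 0 (s p), theta 1 (s p), theta 2 (s p), theta 3 (s p)} \<and>
        (\<forall>i\<le>2. (\<lambda>u v. ext_d (\<lambda>y. theta i (s y)) p u v - wedge (sigma (s p)) (theta (i + 1) (s p)) u v)
                 \<in> ideal2 ((\<lambda>j. theta j (s p)) ` {..i})))"

definition B0 ::
  "(real^5) set \<Rightarrow> (real^3 \<Rightarrow> (real^3) set) \<Rightarrow> (real^5 \<Rightarrow> real^3) \<Rightarrow> (real^5 \<Rightarrow> (real^5) set) \<Rightarrow>
   cfb set" where
  "B0 P D \<rho> L = {(p, s p) |p U s. p \<in> U \<and> zero_adapted P D \<rho> L U s}"

section \<open>The group \<open>G\<^sub>1\<close> and its Lie algebra\<close>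

definition diag5 :: "real \<Rightarrow> real \<Rightarrow> real \<Rightarrow> real \<Rightarrow> real \<Rightarrow> real^5^5" where
  "diag5 d1 d2 d3 d4 d5 = (\<chi> i j. if i = j then
      (if i = 1 then d1 else if i = 2 then d2 else if i = 3 then d3 else if i = 4 then d4 else d5)
    else 0)"

definition lower5 :: "real \<Rightarrow> real^5^5" where
  "lower5 c = (\<chi> i j. if i = 3 \<and> j = 2 then c else if i = 4 \<and> j = 3 then 4/3 * c
                      else if i = 5 \<and> j = 4 then c else 0)"

definition upper5 :: "real \<Rightarrow> real^5^5" where
  "upper5 t = (\<chi> i j. if i = 2 \<and> j = 3 \<or> i = 3 \<and> j = 4 \<or> i = 4 \<and> j = 5 then t else 0)"

definition matrix_exp :: "real^'n^'n \<Rightarrow> real^'n^'n" where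
  "matrix_exp A = (\<Sum>k. (1 / fact k) *\<^sub>R ((\<lambda>B. A ** B) ^^ k) (mat 1))"

definition G1_elt :: "real \<Rightarrow> real \<Rightarrow> real \<Rightarrow> real^5^5" where
  "G1_elt a b c = diag5 a b (b / a) (b / a^2) (b / a^3) ** matrix_exp (lower5 c)"

definition G1 :: "(real^5^5) set" where
  "G1 = {G1_elt a b c |a b c. a \<noteq> 0 \<and> b \<noteq> 0}"

definition g1_elt :: "real \<Rightarrow> real \<Rightarrow> real \<Rightarrow> real^5^5" where
  "g1_elt a b c = diag5 a b (b - a) (b - 2 * a) (b - 3 * a) + lower5 c"

section \<open>Forms on bundles of coframes\<close>

text \<open>
  Functions and forms on a sub-bundle \<open>B\<close> of the coframe bundle are given by functions on
  the ambient space \<open>cfb\<close>.  Only the values at points of \<open>B\<close> matter, and, for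
  1-forms, only their values on vectors tangent to \<open>B\<close>.
\<close>

definition tangent_vectors :: "'a::real_normed_vector set \<Rightarrow> 'a \<Rightarrow> 'a set" where
  "tangent_vectors B z = {X. \<exists>e>0. \<exists>c. smooth_on {-e<..<e::real} c \<and> (\<forall>t\<in>{-e<..<e}. c t \<in> B) \<and>
      c 0 = z \<and> (c has_vector_derivative X) (at 0)}"

definition local_section ::
  "(real^5) set \<Rightarrow> cfb set \<Rightarrow> (real^5) set \<Rightarrow> (real^5 \<Rightarrow> real^5^5) \<Rightarrow> bool" where
  "local_section P B U s \<longleftrightarrow> open U \<and> U \<subseteq> P \<and> smooth_on U s \<and> (\<forall>p\<in>U. (p, s p) \<in> B)"

definition principal_G1_bundle :: "(real^5) set \<Rightarrow> cfb set \<Rightarrow> bool" where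
  "principal_G1_bundle P B \<longleftrightarrow> B \<subseteq> P \<times> UNIV \<and>
     (\<forall>p\<in>P. \<exists>U s. p \<in> U \<and> local_section P B U s \<and>
        (\<forall>y\<in>U. {u. (y, u) \<in> B} = {g ** s y |g. g \<in> G1}))"

text \<open>The local trivialization \<open>U \<times> G\<^sub>1 \<rightarrow> B\<close> given by a section, in the parameters of \<open>G1_elt\<close>.\<close>

definition triv :: "(real^5 \<Rightarrow> real^5^5) \<Rightarrow> (real^5) \<times> real \<times> real \<times> real \<Rightarrow> cfb" where
  "triv s = (\<lambda>(p, a, b, c). (p, G1_elt a b c ** s p))"

definition triv_dom :: "(real^5) set \<Rightarrow> ((real^5) \<times> real \<times> real \<times> real) set" where
  "triv_dom U = {(p, a, b, c). p \<in> U \<and> a \<noteq> 0 \<and> b \<noteq> 0}"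

definition taut_sigma :: "cfb \<Rightarrow> cfb" where
  "taut_sigma z = (sigma (snd z), 0)"

definition taut_theta :: "nat \<Rightarrow> cfb \<Rightarrow> cfb" where
  "taut_theta i z = (theta i (snd z), 0)"

definition structure_equations ::
  "'a::euclidean_space set \<Rightarrow> ('a \<Rightarrow> 'a) \<Rightarrow> (nat \<Rightarrow> 'a \<Rightarrow> 'a) \<Rightarrow> ('a \<Rightarrow> 'a) \<Rightarrow> ('a \<Rightarrow> 'a) \<Rightarrow> ('a \<Rightarrow> 'a) \<Rightarrow>
   (nat \<Rightarrow> 'a \<Rightarrow> real) \<Rightarrow> (nat \<Rightarrow> 'a \<Rightarrow> real) \<Rightarrow> bool" where
  "structure_equations N \<sigma> \<theta> \<alpha> \<beta> \<gamma> I T \<longleftrightarrow> (\<forall>x\<in>N. \<forall>X Y.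
     ext_d \<sigma> x X Y =
         wedge (\<alpha> x) (\<sigma> x) X Y
       + wedge (\<theta> 0 x) (T 1 x *\<^sub>R \<theta> 1 x + T 2 x *\<^sub>R \<theta> 2 x + T 3 x *\<^sub>R \<theta> 3 x) X Y
       + wedge (\<theta> 1 x) (T 4 x *\<^sub>R \<theta> 2 x + T 5 x *\<^sub>R \<theta> 3 x) X Y \<and>
     ext_d (\<theta> 0) x X Y =
         wedge (\<beta> x) (\<theta> 0 x) X Y
       + wedge (\<sigma> x) (\<theta> 1 x) X Y \<and>
     ext_d (\<theta> 1) x X Y =
         wedge (\<beta> x - \<alpha> x) (\<theta> 1 x) X Y
       + wedge (\<gamma> x) (\<theta> 0 x) X Y
       + wedge (\<sigma> x) (\<theta> 2 x) X Y \<and>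
     ext_d (\<theta> 2) x X Y =
         wedge (\<beta> x - 2 *\<^sub>R \<alpha> x) (\<theta> 2 x) X Y
       + 4/3 * wedge (\<gamma> x) (\<theta> 1 x) X Y
       + wedge (\<sigma> x) (\<theta> 3 x) X Y \<and>
     ext_d (\<theta> 3) x X Y =
         wedge (\<beta> x - 3 *\<^sub>R \<alpha> x) (\<theta> 3 x) X Y
       + wedge (\<gamma> x) (\<theta> 2 x) X Y
       + wedge (\<sigma> x) (I 0 x *\<^sub>R \<theta> 0 x + I 1 x *\<^sub>R \<theta> 1 x) X Y
       + T 6 x * wedge (\<theta> 0 x) (\<theta> 1 x) X Y
       + T 7 x * wedge (\<theta> 0 x) (\<theta> 2 x) X Y
       + T 8 x * wedge (\<theta> 1 x) (\<theta> 2 x) X Y)"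

text \<open>
  The forms \<open>\<alpha>, \<beta>, \<gamma>\<close> reproduce the generators of the \<open>G\<^sub>1\<close>-action and are equivariant.
  Since \<open>G\<^sub>1\<close> does not preserve the terms \<open>\<sigma> \<and> \<theta>\<^sub>i\<^sub>+\<^sub>1\<close>, equivariance is that of a Cartan
  connection: it holds for \<open>\<sigma>, \<alpha>, \<beta>, \<gamma>\<close> together, arranged in the matrix with
  \<open>d\<theta> = \<Omega> \<and> \<theta> + ...\<close>, which takes values in the image of \<open>gl(2)\<close> on \<open>Sym\<^sup>3\<close>.
  (The \<open>g1\<close>-valued form by itself cannot be \<open>Ad\<close>-equivariant: \<open>dd\<theta>\<^sub>0 = 0\<close> gives
  \<open>d\<beta> \<equiv> \<sigma> \<and> \<gamma>\<close> modulo \<open>\<theta>\<^sub>0\<close> and products of two horizontal forms.)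
\<close>

definition Omega ::
  "(cfb \<Rightarrow> cfb) \<Rightarrow>
   (cfb \<Rightarrow> cfb) \<Rightarrow>
   (cfb \<Rightarrow> cfb) \<Rightarrow>
   cfb \<Rightarrow> cfb \<Rightarrow> real^5^5" where
  "Omega \<alpha> \<beta> \<gamma> z X =
     (let a = \<alpha> z \<bullet> X; b = \<beta> z \<bullet> X in
      diag5 0 b (b - a) (b - 2 * a) (b - 3 * a) + lower5 (\<gamma> z \<bullet> X) + upper5 (taut_sigma z \<bullet> X))"

definition equivariant_connection ::
  "cfb set \<Rightarrow>
   (cfb \<Rightarrow> cfb) \<Rightarrow>
   (cfb \<Rightarrow> cfb) \<Rightarrow>
   (cfb \<Rightarrow> cfb) \<Rightarrow> bool" where
  "equivariant_connection B \<alpha> \<beta> \<gamma> \<longleftrightarrow>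
     (\<forall>p u. (p, u) \<in> B \<longrightarrow>
        (\<forall>a b c. let X = (0, g1_elt a b c ** u) in
            \<alpha> (p, u) \<bullet> X = a \<and> \<beta> (p, u) \<bullet> X = b \<and> \<gamma> (p, u) \<bullet> X = c) \<and>
        (\<forall>g\<in>G1. \<forall>v w. (v, w) \<in> tangent_vectors B (p, u) \<longrightarrow>
            Omega \<alpha> \<beta> \<gamma> (p, g ** u) (v, g ** w) = g ** Omega \<alpha> \<beta> \<gamma> (p, u) (v, w) ** matrix_inv g))"

text \<open>
  The bundle \<open>B\<^sub>1\<close> together with its connection forms and torsion functions.  Forms on \<open>B\<^sub>1\<close>
  are differentiated in the local trivializations.
\<close>

definition fels_structure ::
  "(real^5) set \<Rightarrow> (real^3 \<Rightarrow> (real^3) set) \<Rightarrow> (real^5 \<Rightarrow> real^3) \<Rightarrow> (real^5 \<Rightarrow> (real^5) set) \<Rightarrow>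
   cfb set \<Rightarrow>
   (cfb \<Rightarrow> cfb) \<Rightarrow>
   (cfb \<Rightarrow> cfb) \<Rightarrow>
   (cfb \<Rightarrow> cfb) \<Rightarrow>
   (nat \<Rightarrow> cfb \<Rightarrow> real) \<Rightarrow> (nat \<Rightarrow> cfb \<Rightarrow> real) \<Rightarrow> bool" where
  "fels_structure P D \<rho> L B1 \<alpha> \<beta> \<gamma> I T \<longleftrightarrow>
     B1 \<subseteq> B0 P D \<rho> L \<and> principal_G1_bundle P B1 \<and> equivariant_connection B1 \<alpha> \<beta> \<gamma> \<and>
     (\<forall>U s. local_section P B1 U s \<longrightarrow>
        (\<forall>\<omega>\<in>{\<alpha>, \<beta>, \<gamma>}. smooth_on (triv_dom U) (pullback (triv s) \<omega>)) \<and>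
        (\<forall>i\<le>1. smooth_on (triv_dom U) (I i \<circ> triv s)) \<and>
        (\<forall>i\<in>{1..8}. smooth_on (triv_dom U) (T i \<circ> triv s)) \<and>
        structure_equations (triv_dom U)
          (pullback (triv s) taut_sigma) (\<lambda>i. pullback (triv s) (taut_theta i))
          (pullback (triv s) \<alpha>) (pullback (triv s) \<beta>) (pullback (triv s) \<gamma>)
          (\<lambda>i. I i \<circ> triv s) (\<lambda>i. T i \<circ> triv s))"

definition variational ::
  "cfb set \<Rightarrow> (nat \<Rightarrow> cfb \<Rightarrow> real) \<Rightarrow>
   (nat \<Rightarrow> cfb \<Rightarrow> real) \<Rightarrow> bool" where
  "variational B1 I T \<longleftrightarrow> (\<forall>z\<in>B1. I 1 z = 0 \<and> T 5 z = 0 \<and> T 8 z = 0)"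

definition definite_variational ::
  "cfb set \<Rightarrow> (nat \<Rightarrow> cfb \<Rightarrow> real) \<Rightarrow>
   (nat \<Rightarrow> cfb \<Rightarrow> real) \<Rightarrow> bool" where
  "definite_variational B1 I T \<longleftrightarrow> variational B1 I T \<and> (\<forall>z\<in>B1. T 4 z < 0)"

definition B2 ::
  "cfb set \<Rightarrow> (nat \<Rightarrow> cfb \<Rightarrow> real) \<Rightarrow> cfb set" where
  "B2 B1 T = {z \<in> B1. T 2 z = 0 \<and> T 4 z = -1}"

text \<open>
  \<open>\<beta> = 2\<alpha> + W\<^sub>0\<theta>\<^sub>0 + W\<^sub>1\<theta>\<^sub>1 + W\<^sub>2\<theta>\<^sub>2\<close> on \<open>B\<^sub>2\<close>, as forms on the manifold \<open>B\<^sub>2\<close>.  The equation determines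
  \<open>W\<^sub>0, W\<^sub>1, W\<^sub>2\<close> on \<open>B\<^sub>2\<close>, because the \<open>\<theta>\<^sub>i\<close> are independent there.
\<close>

definition W_functions ::
  "(real^5) set \<Rightarrow> cfb set \<Rightarrow>
   (cfb \<Rightarrow> cfb) \<Rightarrow>
   (cfb \<Rightarrow> cfb) \<Rightarrow>
   (nat \<Rightarrow> cfb \<Rightarrow> real) \<Rightarrow> bool" where
  "W_functions P B \<alpha> \<beta> W \<longleftrightarrow>
     (\<forall>U s. local_section P B U s \<longrightarrow> (\<forall>i\<le>2. smooth_on U (\<lambda>p. W i (p, s p)))) \<and>
     (\<forall>z\<in>B. \<forall>X\<in>tangent_vectors B z.
        \<beta> z \<bullet> X = (2 *\<^sub>R \<alpha> z + (\<Sum>i\<le>2. W i z *\<^sub>R taut_theta i z)) \<bullet> X)"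

definition canonical_coframe ::
  "(real^5) set \<Rightarrow> cfb set \<Rightarrow>
   (cfb \<Rightarrow> cfb) \<Rightarrow>
   (cfb \<Rightarrow> cfb) \<Rightarrow> (real^5 \<Rightarrow> real^5^5) \<Rightarrow> bool" where
  "canonical_coframe P B \<alpha> \<beta> s \<longleftrightarrow> local_section P B P s \<and>
     (\<forall>p\<in>P. pullback (\<lambda>y. (y, s y)) (\<lambda>z. 3 *\<^sub>R \<alpha> z - 2 *\<^sub>R \<beta> z) p = 0)"

section \<open>Metrics on the contact planes\<close>

text \<open>Only the values of \<open>h q\<close> on the plane \<open>D q\<close> matter.\<close>

definition contact_metric ::
  "(real^3) set \<Rightarrow> (real^3 \<Rightarrow> (real^3) set) \<Rightarrow> (real^3 \<Rightarrow> real^3 \<Rightarrow> real^3 \<Rightarrow> real) \<Rightarrow> bool" where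
  "contact_metric M D h \<longleftrightarrow>
     (\<forall>q\<in>M. bilinear (h q) \<and> (\<forall>u\<in>D q. \<forall>v\<in>D q. h q u v = h q v u) \<and>
              (\<forall>u\<in>D q. u \<noteq> 0 \<longrightarrow> h q u u > 0)) \<and>
     (\<forall>U X Y. open U \<and> U \<subseteq> M \<and> smooth_on U X \<and> smooth_on U Y \<and> (\<forall>y\<in>U. X y \<in> D y \<and> Y y \<in> D y) \<longrightarrow>
        smooth_on U (\<lambda>y. h y (X y) (Y y)))"

definition well_defined_contact_metric ::
  "(real^5) set \<Rightarrow> (real^3) set \<Rightarrow> (real^3 \<Rightarrow> (real^3) set) \<Rightarrow> (real^5 \<Rightarrow> real^3) \<Rightarrow>
   (real^5 \<Rightarrow> real^5^5) \<Rightarrow> (real^5 \<Rightarrow> real^5 \<Rightarrow> real^5 \<Rightarrow> real) \<Rightarrow> bool" where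
  "well_defined_contact_metric P M D \<rho> s g \<longleftrightarrow>
     (\<exists>h. contact_metric M D h \<and>
        (\<forall>p\<in>P. \<forall>u v. theta 0 (s p) \<bullet> u = 0 \<and> theta 0 (s p) \<bullet> v = 0 \<longrightarrow>
            g p u v = h (\<rho> p) (tmap \<rho> p u) (tmap \<rho> p v)))"

definition g_metric :: "(real^5 \<Rightarrow> real^5^5) \<Rightarrow> real^5 \<Rightarrow> real^5 \<Rightarrow> real^5 \<Rightarrow> real" where
  "g_metric s p u v =
     (sigma (s p) \<bullet> u) * (sigma (s p) \<bullet> v) + (theta 1 (s p) \<bullet> u) * (theta 1 (s p) \<bullet> v)"

end

theory Submission
  imports Defs
begin

text \<open>
  The forms \<open>\<sigma>, \<theta>\<^sub>0, \<theta>\<^sub>1\<close> vanish on the fibres of \<open>\<rho>\<close>: for \<open>\<theta>\<^sub>0\<close> and \<open>\<theta>\<^sub>1\<close> because they lie in \<open>\<I>\<close>,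
  and for \<open>\<sigma>\<close> because the kernel of \<open>\<theta>\<^sub>0\<close> is constant along the fibres while
  \<open>v \<lrcorner> d\<theta>\<^sub>0 \<equiv> \<sigma>(v) \<theta>\<^sub>1\<close> modulo \<open>\<theta>\<^sub>0\<close> for vertical \<open>v\<close>.
  Hence they are \<open>b \<circ> d\<rho>\<close> for functions \<open>b\<close> with values in the covectors of \<open>M\<close>, and the
  derivative of \<open>b\<close> along \<open>v\<close> is given by \<open>v \<lrcorner> d\<sigma>\<close>, \<open>v \<lrcorner> d\<theta>\<^sub>1\<close>.  On a canonical coframe
  \<open>\<alpha>(v) = -2 W\<^sub>2 \<theta>\<^sub>2(v)\<close> and \<open>\<beta>(v) = -3 W\<^sub>2 \<theta>\<^sub>2(v)\<close>, and the structure equations with \<open>T\<^sub>4 = -1\<close> give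
  the derivative \<open>-2 W\<^sub>2 \<theta>\<^sub>2(v) (2\<sigma>\<^sup>2 + \<theta>\<^sub>1\<^sup>2)\<close> of \<open>g\<close> modulo \<open>\<theta>\<^sub>0\<close>: the contributions \<open>\<plusminus>2\<theta>\<^sub>2(v)\<sigma>\<theta>\<^sub>1\<close> of
  the two summands cancel.  Since the fibres are connected, \<open>g\<close> descends exactly when this vanishes.
\<close>

section \<open>Calculus of smooth maps\<close>

lemma Ck_on_cong:
  assumes "open U" "\<And>x. x \<in> U \<Longrightarrow> f x = g x" "Ck_on k U f"
  shows "Ck_on k U g"
  using assms(2,3)
proof (induction k arbitrary: f g)
  case 0
  then show ?case by (metis Ck_on.simps(1) continuous_on_cong)
next
  case (Suc k)
  have d: "(g has_derivative tmap f x) (at x)" if "x \<in> U" for x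
    using has_derivative_transform_within_open[OF _ \<open>open U\<close> that Suc.prems(1)] Suc.prems(2) that
    by (auto simp: frechet_derivative_works)
  then have eq: "tmap g x = tmap f x" if "x \<in> U" for x
    using frechet_derivative_at that by metis
  show ?case
    unfolding Ck_on.simps
  proof (intro conjI ballI allI)
    show "g differentiable (at x)" if "x \<in> U" for x
      using d[OF that] by (auto simp: differentiable_def)
    show "Ck_on k U (\<lambda>x. tmap g x v)" for v
      by (rule Suc.IH[of "\<lambda>x. tmap f x v"]) (use eq Suc.prems in auto)
  qed
qed

lemma Ck_on_SucD:
  assumes "Ck_on (Suc k) U f" "x \<in> U"
  shows "(f has_derivative tmap f x) (at x)"
  using assms by (simp add: frechet_derivative_works)

text \<open>A derivative is unique on an open set, so any known formula for it can stand in for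
  \<open>frechet_derivative\<close>. This turns each closure property below into an induction on a
  derivative formula.\<close>

lemma Ck_on_SucI:
  assumes "open U" "\<And>x. x \<in> U \<Longrightarrow> (f has_derivative f' x) (at x)"
    and "\<And>v. Ck_on k U (\<lambda>x. f' x v)"
  shows "Ck_on (Suc k) U f"
  unfolding Ck_on.simps
proof (intro conjI ballI allI)
  show "f differentiable (at x)" if "x \<in> U" for x
    using assms(2)[OF that] by (auto simp: differentiable_def)
  show "Ck_on k U (\<lambda>x. tmap f x v)" for v
  proof (rule Ck_on_cong[OF assms(1) _ assms(3)[of v]])
    show "f' x v = tmap f x v" if "x \<in> U" for x
      by (rule fun_cong[OF frechet_derivative_at[OF assms(2)[OF that]]])
  qed
qed

lemma Ck_on_decrease:
  "Ck_on (Suc k) U f \<Longrightarrow> Ck_on k U f"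
proof (induction k arbitrary: f)
  case 0
  then show ?case
    by (simp add: continuous_at_imp_continuous_on differentiable_imp_continuous_within)
next
  case (Suc k)
  then show ?case
    by (metis Ck_on.simps(2))
qed

lemma Ck_on_subset:
  "Ck_on k U f \<Longrightarrow> V \<subseteq> U \<Longrightarrow> Ck_on k V f"
  by (induction k arbitrary: f) (auto intro: continuous_on_subset)

lemma Ck_on_const: "Ck_on k U (\<lambda>x. c)"
  by (induction k arbitrary: c) auto

lemma Ck_on_ident: "open U \<Longrightarrow> Ck_on k U (\<lambda>x. x)"
  by (cases k) (auto simp: Ck_on_const)

lemma Ck_on_linear:
  assumes "open U" "bounded_linear T" "Ck_on k U f"
  shows "Ck_on k U (\<lambda>x. T (f x))"
  using assms(3)
proof (induction k arbitrary: f)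
  case 0
  then show ?case
    using assms(2) by (auto intro: bounded_linear.continuous_on)
next
  case (Suc k)
  show ?case
    by (rule Ck_on_SucI[OF assms(1), where f' = "\<lambda>x v. T (tmap f x v)"])
      (use Suc bounded_linear.has_derivative[OF assms(2) Ck_on_SucD[OF Suc.prems]] in auto)
qed

lemma Ck_on_add:
  assumes "open U" "Ck_on k U f" "Ck_on k U g"
  shows "Ck_on k U (\<lambda>x. f x + g x)"
  using assms(2,3)
proof (induction k arbitrary: f g)
  case 0
  then show ?case by (simp add: continuous_on_add)
next
  case (Suc k)
  show ?case
    by (rule Ck_on_SucI[OF assms(1) has_derivative_add[OF Ck_on_SucD[OF Suc.prems(1)] Ck_on_SucD[OF Suc.prems(2)]]])
      (use Suc in auto)
qed

lemma Ck_on_sum: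
  assumes "open U" "\<And>i. i \<in> S \<Longrightarrow> Ck_on k U (f i)"
  shows "Ck_on k U (\<lambda>x. \<Sum>i\<in>S. f i x)"
  using assms(2)
  by (induction S rule: infinite_finite_induct) (auto intro: Ck_on_add assms(1) Ck_on_const)

text \<open>By the Leibniz rule the derivative is a sum of two terms of the same bilinear shape. One
  factor of each is undifferentiated and is brought down to order \<open>k\<close> by
  \<open>Ck_on_decrease\<close>.\<close>

lemma Ck_on_bilinear:
  assumes "open U" "bounded_bilinear pr" "Ck_on k U f" "Ck_on k U g"
  shows "Ck_on k U (\<lambda>x. pr (f x) (g x))"
  using assms(3,4)
proof (induction k arbitrary: f g)
  case 0
  then show ?case
    using assms(2) by (auto intro: bounded_bilinear.continuous_on)
next
  case (Suc k)
  have *: "Ck_on k U (\<lambda>x. pr (f x) (tmap g x v) + pr (tmap f x v) (g x))" for v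
    by (intro Ck_on_add assms(1) Suc.IH Suc.prems[THEN Ck_on_decrease]) (use Suc.prems in auto)
  show ?case
    by (rule Ck_on_SucI[OF assms(1) bounded_bilinear.FDERIV[OF assms(2) Ck_on_SucD[OF Suc.prems(1)] Ck_on_SucD[OF Suc.prems(2)]]])
      (use * in simp_all)
qed

lemmas Ck_on_mult = Ck_on_bilinear[OF _ bounded_bilinear_mult]
lemmas Ck_on_scaleR = Ck_on_bilinear[OF _ bounded_bilinear_scaleR]
lemmas Ck_on_inner = Ck_on_bilinear[OF _ bounded_bilinear_inner]

lemma Ck_on_prod:
  fixes f :: "'i \<Rightarrow> 'a::real_normed_vector \<Rightarrow> real"
  assumes "open U" "\<And>i. i \<in> S \<Longrightarrow> Ck_on k U (f i)"
  shows "Ck_on k U (\<lambda>x. \<Prod>i\<in>S. f i x)"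
  using assms(2)
  by (induction S rule: infinite_finite_induct) (auto intro: Ck_on_mult assms(1) Ck_on_const)

lemma Ck_on_inverse:
  fixes f :: "'a::real_normed_vector \<Rightarrow> real"
  assumes "open U" "\<And>x. x \<in> U \<Longrightarrow> f x \<noteq> 0" "Ck_on k U f"
  shows "Ck_on k U (\<lambda>x. inverse (f x))"
  using assms(3)
proof (induction k)
  case 0
  then show ?case using assms(2) by (simp add: continuous_on_inverse)
next
  case (Suc k)
  have f: "Ck_on k U (\<lambda>x. inverse (f x))"
    using Suc Ck_on_decrease by blast
  show ?case
  proof (rule Ck_on_SucI[OF assms(1)])
    show "((\<lambda>x. inverse (f x)) has_derivative (\<lambda>h. - (inverse (f x) * tmap f x h * inverse (f x)))) (at x)"
      if "x \<in> U" for x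
      by (rule Deriv.has_derivative_inverse[OF assms(2)[OF that] Ck_on_SucD[OF Suc.prems that]])
    show "Ck_on k U (\<lambda>x. - (inverse (f x) * tmap f x v * inverse (f x)))" for v
      by (intro Ck_on_linear[OF _ bounded_linear_minus[OF bounded_linear_ident]] Ck_on_mult f assms(1))
        (use Suc.prems in auto)
  qed
qed

lemma linear_expand_basis:
  fixes T :: "'a::euclidean_space \<Rightarrow> 'b::real_normed_vector"
  assumes "linear T"
  shows "T v = (\<Sum>e\<in>Basis. (v \<bullet> e) *\<^sub>R T e)"
proof -
  have "T v = T (\<Sum>e\<in>Basis. (v \<bullet> e) *\<^sub>R e)"
    by (simp add: euclidean_representation)
  then show ?thesis
    by (simp add: linear_sum[OF assms] linear_scale[OF assms])
qed

lemma Ck_on_compose: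
  fixes f :: "'a::real_normed_vector \<Rightarrow> 'b::euclidean_space"
    and g :: "'b \<Rightarrow> 'c::real_normed_vector"
  assumes "open U" "open V" "f ` U \<subseteq> V" "Ck_on k U f" "Ck_on k V g"
  shows "Ck_on k U (\<lambda>x. g (f x))"
  using assms(4,5)
proof (induction k arbitrary: g)
  case 0
  then show ?case
    using assms(3) by (auto intro: continuous_on_compose2)
next
  case (Suc k)
  have lin: "linear (tmap g (f x))" if "x \<in> U" for x
    using Suc.prems(2) that assms(3) by (auto intro: linear_frechet_derivative)
  show ?case
  proof (rule Ck_on_SucI[OF assms(1)])
    \<comment> \<open>The chain rule differentiates \<open>g\<close> in a direction that varies with
      \<open>x\<close>. Expanding this direction in the basis leaves derivatives of \<open>g\<close>
      in constant directions, to which the induction hypothesis applies.\<close>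
    show "((\<lambda>x. g (f x)) has_derivative (\<lambda>v. \<Sum>e\<in>Basis. (tmap f x v \<bullet> e) *\<^sub>R tmap g (f x) e)) (at x)"
      if "x \<in> U" for x
    proof -
      have "((\<lambda>x. g (f x)) has_derivative (\<lambda>v. tmap g (f x) (tmap f x v))) (at x)"
        using that assms(3)
        by (intro has_derivative_compose[where f = f and g = g]
            Ck_on_SucD[OF Suc.prems(1) that] Ck_on_SucD[OF Suc.prems(2)]) blast
      also have "(\<lambda>v. tmap g (f x) (tmap f x v)) = (\<lambda>v. \<Sum>e\<in>Basis. (tmap f x v \<bullet> e) *\<^sub>R tmap g (f x) e)"
        by (rule ext) (rule linear_expand_basis[OF lin[OF that]])
      finally show ?thesis .
    qed
    have *: "Ck_on k U (\<lambda>x. tmap f x v)" "Ck_on k V (\<lambda>x. tmap g x e)" for v e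
      using Suc.prems by simp_all
    show "Ck_on k U (\<lambda>x. \<Sum>e\<in>Basis. (tmap f x v \<bullet> e) *\<^sub>R tmap g (f x) e)" for v
      by (rule Ck_on_sum[OF assms(1) Ck_on_scaleR[OF assms(1)
            Ck_on_inner[OF assms(1) *(1) Ck_on_const]
            Suc.IH[OF Ck_on_decrease[OF Suc.prems(1)] *(2)]]])
  qed
qed

lemma smooth_on_has_derivative:
  "smooth_on U f \<Longrightarrow> x \<in> U \<Longrightarrow> (f has_derivative tmap f x) (at x)"
  unfolding smooth_on_def by (blast intro: Ck_on_SucD)

lemma smooth_on_tmap: "smooth_on U f \<Longrightarrow> smooth_on U (\<lambda>x. tmap f x v)"
  unfolding smooth_on_def by (metis Ck_on.simps(2))

lemma Ck_on_det:
  fixes A :: "'a::real_normed_vector \<Rightarrow> real^'n^'n"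
  assumes "open U" "\<And>i j. Ck_on k U (\<lambda>x. A x $ i $ j)"
  shows "Ck_on k U (\<lambda>x. det (A x))"
  unfolding det_def by (intro Ck_on_sum Ck_on_mult Ck_on_const Ck_on_prod assms)

section \<open>Symmetry of second derivatives\<close>

lemma symmetric_second_derivative_real:
  fixes f :: "'a::real_normed_vector \<Rightarrow> real"
  assumes "open U" "Ck_on 2 U f" "x \<in> U"
  shows "tmap (\<lambda>y. tmap f y u) x v = tmap (\<lambda>y. tmap f y v) x u"
proof (rule ccontr)
  define a where "a u v y = tmap (\<lambda>y. tmap f y u) y v" for u v y
  assume "\<not> ?thesis"
  then have ne: "a u v x \<noteq> a v u x" by (simp add: a_def)
  \<comment> \<open>Half the gap between the two mixed derivatives at \<open>x\<close>: values
    within \<epsilon> of the one and of the other cannot coincide.\<close>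
  define \<epsilon> where "\<epsilon> = \<bar>a u v x - a v u x\<bar> / 2"
  have "\<epsilon> > 0" using ne by (simp add: \<epsilon>_def)
  have C: "Ck_on (Suc (Suc 0)) U f" using assms(2) by (simp add: numeral_2_eq_2)
  have cont: "continuous_on U (a u v)" for u v
    using C by (auto simp: a_def)
  have d1: "(f has_derivative tmap f y) (at y)" if "y \<in> U" for y
    using C that by (rule Ck_on_SucD)
  have d2: "((\<lambda>y. tmap f y u) has_derivative tmap (\<lambda>y. tmap f y u) y) (at y)" if "y \<in> U" for y u
    by (rule Ck_on_SucD[of 0, OF _ that]) (use C in \<open>simp del: Ck_on.simps(1)\<close>)
  obtain \<delta> where \<delta>: "\<delta> > 0" "ball x \<delta> \<subseteq> U"
      "\<And>y. y \<in> ball x \<delta> \<Longrightarrow> \<bar>a u v y - a u v x\<bar> < \<epsilon>" "\<And>y. y \<in> ball x \<delta> \<Longrightarrow> \<bar>a v u y - a v u x\<bar> < \<epsilon>"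
  proof -
    obtain r where r: "r > 0" "ball x r \<subseteq> U" using assms(1,3) openE by blast
    have "\<exists>d>0. \<forall>y\<in>ball x d. y \<in> U \<longrightarrow> \<bar>a u v y - a u v x\<bar> < \<epsilon>" for u v
    proof -
      obtain d where "d > 0" "\<forall>y\<in>U. dist y x < d \<longrightarrow> dist (a u v y) (a u v x) < \<epsilon>"
        using cont[of u v] \<open>\<epsilon> > 0\<close> assms(3) unfolding continuous_on_iff by blast
      then show ?thesis by (auto simp: dist_real_def dist_commute intro!: exI[of _ d])
    qed
    then obtain d1 d2 where "d1 > 0" "\<forall>y\<in>ball x d1. y \<in> U \<longrightarrow> \<bar>a u v y - a u v x\<bar> < \<epsilon>"
      "d2 > 0" "\<forall>y\<in>ball x d2. y \<in> U \<longrightarrow> \<bar>a v u y - a v u x\<bar> < \<epsilon>" by metis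
    then show ?thesis using r by (intro that[of "min r (min d1 d2)"]) auto
  qed
  \<comment> \<open>Small enough that the parallelogram with sides \<open>h *\<^sub>R u\<close> and
    \<open>h *\<^sub>R v\<close> stays in the ball; the summand 1 keeps the denominator positive
    when both vectors vanish.\<close>
  define h where "h = \<delta> / (norm u + norm v + 1) / 2"
  have n0: "norm u + norm v + 1 > 0" by (simp add: add_nonneg_pos)
  have "h > 0" using \<delta>(1) n0 by (simp add: h_def)
  have inb: "x + s *\<^sub>R u + t *\<^sub>R v \<in> ball x \<delta>" if "0 \<le> s" "s \<le> h" "0 \<le> t" "t \<le> h" for s t
  proof -
    have "norm (s *\<^sub>R u + t *\<^sub>R v) \<le> s * norm u + t * norm v"
      using that norm_triangle_ineq[of "s *\<^sub>R u" "t *\<^sub>R v"] by simp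
    also have "\<dots> \<le> h * norm u + h * norm v"
      using that by (intro add_mono mult_right_mono) auto
    also have "\<dots> \<le> h * (norm u + norm v + 1)"
      using \<open>h > 0\<close> by (simp add: algebra_simps)
    also have "\<dots> = \<delta> / 2" using n0 by (simp add: h_def field_simps)
    also have "\<dots> < \<delta>" using \<delta>(1) by simp
    finally have "norm (s *\<^sub>R u + t *\<^sub>R v) < \<delta>" .
    moreover have "x - (x + s *\<^sub>R u + t *\<^sub>R v) = - (s *\<^sub>R u + t *\<^sub>R v)"
      by simp
    ultimately show ?thesis
      by (metis dist_norm mem_ball norm_minus_cancel)
  qed
  \<comment> \<open>the second difference of \<open>f\<close>, evaluated by two applications of the mean value theorem\<close>
  have key: "\<exists>y\<in>ball x \<delta>. f (x + h *\<^sub>R u + h *\<^sub>R v) - f (x + h *\<^sub>R u) - f (x + h *\<^sub>R v) + f x = h * (h * a u v y)"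
    if inb: "\<And>s t. 0 \<le> s \<Longrightarrow> s \<le> h \<Longrightarrow> 0 \<le> t \<Longrightarrow> t \<le> h \<Longrightarrow> x + s *\<^sub>R u + t *\<^sub>R v \<in> ball x \<delta>" for u v
  proof -
    have ds: "((\<lambda>s. f (x + s *\<^sub>R u + t *\<^sub>R v)) has_real_derivative tmap f (x + s *\<^sub>R u + t *\<^sub>R v) u) (at s)"
      if "x + s *\<^sub>R u + t *\<^sub>R v \<in> U" for s t
    proof -
      have "((\<lambda>s. f (x + s *\<^sub>R u + t *\<^sub>R v)) has_derivative (\<lambda>r. tmap f (x + s *\<^sub>R u + t *\<^sub>R v) (r *\<^sub>R u))) (at s)"
        by (rule has_derivative_compose[where f = "\<lambda>s. x + s *\<^sub>R u + t *\<^sub>R v" and g = f, OF _ d1[OF that]]) (auto intro!: derivative_eq_intros)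
      then show ?thesis
        using linear_scale[OF has_derivative_linear[OF d1[OF that]]]
        by (simp add: has_field_derivative_def mult.commute[of "tmap f (x + s *\<^sub>R u + t *\<^sub>R v) u"] mult_commute_abs)
    qed
    have dt: "((\<lambda>t. tmap f (x + s *\<^sub>R u + t *\<^sub>R v) u) has_real_derivative a u v (x + s *\<^sub>R u + t *\<^sub>R v)) (at t)"
      if "x + s *\<^sub>R u + t *\<^sub>R v \<in> U" for s t
    proof -
      have "((\<lambda>t. tmap f (x + s *\<^sub>R u + t *\<^sub>R v) u) has_derivative (\<lambda>r. tmap (\<lambda>y. tmap f y u) (x + s *\<^sub>R u + t *\<^sub>R v) (r *\<^sub>R v))) (at t)"
        by (rule has_derivative_compose[where f = "\<lambda>t. x + s *\<^sub>R u + t *\<^sub>R v" and g = "\<lambda>y. tmap f y u", OF _ d2[OF that]]) (auto intro!: derivative_eq_intros)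
      then show ?thesis
        using linear_scale[OF has_derivative_linear[OF d2[OF that]]]
        by (simp add: a_def has_field_derivative_def mult_commute_abs)
    qed
    have inU: "x + s *\<^sub>R u + t *\<^sub>R v \<in> U" if "0 \<le> s" "s \<le> h" "0 \<le> t" "t \<le> h" for s t
      using inb[OF that] \<delta>(2) by blast
    have "((\<lambda>s. f (x + s *\<^sub>R u + h *\<^sub>R v) - f (x + s *\<^sub>R u + 0 *\<^sub>R v)) has_real_derivative
        tmap f (x + s *\<^sub>R u + h *\<^sub>R v) u - tmap f (x + s *\<^sub>R u + 0 *\<^sub>R v) u) (at s)"
      if "0 \<le> s" "s \<le> h" for s
      using that \<open>h > 0\<close> by (intro DERIV_diff ds inU) auto
    from MVT2[OF \<open>h > 0\<close> this] obtain s where s: "0 < s" "s < h" 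
      "(f (x + h *\<^sub>R u + h *\<^sub>R v) - f (x + h *\<^sub>R u + 0 *\<^sub>R v)) - (f (x + 0 *\<^sub>R u + h *\<^sub>R v) - f (x + 0 *\<^sub>R u + 0 *\<^sub>R v))
        = (h - 0) * (tmap f (x + s *\<^sub>R u + h *\<^sub>R v) u - tmap f (x + s *\<^sub>R u + 0 *\<^sub>R v) u)"
      by blast
    have "((\<lambda>t. tmap f (x + s *\<^sub>R u + t *\<^sub>R v) u) has_real_derivative a u v (x + s *\<^sub>R u + t *\<^sub>R v)) (at t)"
      if "0 \<le> t" "t \<le> h" for t
      using that s by (intro dt inU) auto
    from MVT2[OF \<open>h > 0\<close> this] obtain t where t: "0 < t" "t < h" 
      "tmap f (x + s *\<^sub>R u + h *\<^sub>R v) u - tmap f (x + s *\<^sub>R u + 0 *\<^sub>R v) u = (h - 0) * a u v (x + s *\<^sub>R u + t *\<^sub>R v)"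
      by blast
    show ?thesis
      using s t by (intro bexI[of _ "x + s *\<^sub>R u + t *\<^sub>R v"] inb) auto
  qed
  obtain y where y: "y \<in> ball x \<delta>" "f (x + h *\<^sub>R u + h *\<^sub>R v) - f (x + h *\<^sub>R u) - f (x + h *\<^sub>R v) + f x = h * (h * a u v y)"
    using key[of u v] inb by auto
  have "x + s *\<^sub>R v + t *\<^sub>R u \<in> ball x \<delta>" if "0 \<le> s" "s \<le> h" "0 \<le> t" "t \<le> h" for s t
    using inb[of t s] that by (simp add: add.commute add.left_commute)
  then obtain z where z: "z \<in> ball x \<delta>" "f (x + h *\<^sub>R v + h *\<^sub>R u) - f (x + h *\<^sub>R v) - f (x + h *\<^sub>R u) + f x = h * (h * a v u z)"
    using key[of v u] by blast
  \<comment> \<open>The second difference does not change when \<open>u\<close> and \<open>v\<close>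
    are exchanged, so a value of each mixed derivative near \<open>x\<close> agrees with a value of
    the other.\<close>
  have "h * (h * a u v y) = h * (h * a v u z)"
    using y(2) z(2) unfolding add.assoc[of x] add.commute[of "h *\<^sub>R v"] by linarith
  then have "a u v y = a v u z" using \<open>h > 0\<close> by simp
  then show False
    using \<delta>(3)[OF y(1)] \<delta>(4)[OF z(1)] unfolding \<epsilon>_def by argo
qed

lemma symmetric_second_derivative:
  fixes f :: "'a::real_normed_vector \<Rightarrow> 'b::euclidean_space"
  assumes "open U" "smooth_on U f" "x \<in> U"
  shows "tmap (\<lambda>y. tmap f y u) x v = tmap (\<lambda>y. tmap f y v) x u"
proof (rule euclidean_eqI)
  fix e :: 'b
  have C: "Ck_on 2 U (\<lambda>y. f y \<bullet> e)"
    using assms by (intro Ck_on_inner Ck_on_const) (auto simp: smooth_on_def)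
  have d1: "tmap (\<lambda>y. f y \<bullet> e) y u = tmap f y u \<bullet> e" if "y \<in> U" for y u
    using has_derivative_inner_left[OF smooth_on_has_derivative[OF assms(2) that], of e]
    by (metis frechet_derivative_at)
  have d2: "tmap (\<lambda>y. tmap (\<lambda>y. f y \<bullet> e) y u) x v = tmap (\<lambda>y. tmap f y u) x v \<bullet> e" for u v
  proof -
    have "((\<lambda>y. tmap f y u \<bullet> e) has_derivative (\<lambda>v. tmap (\<lambda>y. tmap f y u) x v \<bullet> e)) (at x)"
      by (intro has_derivative_inner_left smooth_on_has_derivative[OF smooth_on_tmap[OF assms(2)] assms(3)])
    then have "((\<lambda>y. tmap (\<lambda>y. f y \<bullet> e) y u) has_derivative (\<lambda>v. tmap (\<lambda>y. tmap f y u) x v \<bullet> e)) (at x)"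
      by (rule has_derivative_transform_within_open[OF _ assms(1,3)]) (use d1 in auto)
    then show ?thesis by (metis frechet_derivative_at)
  qed
  show "tmap (\<lambda>y. tmap f y u) x v \<bullet> e = tmap (\<lambda>y. tmap f y v) x u \<bullet> e"
    using symmetric_second_derivative_real[OF assms(1) C assms(3), of u v] by (simp add: d2)
qed

section \<open>Submersions\<close>

text \<open>The fibres become pieces of translates of the kernel of \<open>tmap \<rho> p0\<close>.
  The last conclusion says that the chart leaves tangent vectors at \<open>p0\<close> unchanged, so
  that a straight line in the chart realizes a prescribed vector there.\<close>

lemma submersion_chart:
  fixes \<rho> :: "'a::euclidean_space \<Rightarrow> 'b::euclidean_space"
  assumes "open P" "smooth_on P \<rho>" "p0 \<in> P" "surj (tmap \<rho> p0)"
  obtains U V F G G' where "open U" "p0 \<in> U" "U \<subseteq> P" "open V" "continuous_on U F"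
    "\<And>p. p \<in> U \<Longrightarrow> F p \<in> V \<and> G (F p) = p \<and> tmap \<rho> p0 (F p) = \<rho> p"
    "\<And>y. y \<in> V \<Longrightarrow> G y \<in> U \<and> \<rho> (G y) = tmap \<rho> p0 y \<and> (G has_derivative G' y) (at y)"
    "\<And>v. G' (F p0) v = v"
proof -
  define K where "K = tmap \<rho> p0"
  have d\<rho>: "(\<rho> has_derivative tmap \<rho> p) (at p)" if "p \<in> P" for p
    using smooth_on_has_derivative assms(2) that by blast
  have linK: "linear K" unfolding K_def using d\<rho>[OF assms(3)] by (rule has_derivative_linear)
  obtain R where R: "linear R" "\<And>x. K (R x) = x"
    using linear_surjective_right_inverse[OF linK] assms(4) by (auto simp: K_def fun_eq_iff)
  have bl: "bounded_linear R" "bounded_linear K"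
    using R(1) linK by (auto simp: linear_conv_bounded_linear)
  \<comment> \<open>a chart of \<open>P\<close> with derivative the identity at \<open>p0\<close> in which \<open>\<rho>\<close> is the linear map \<open>K\<close>\<close>
  define F where "F p = p + R (\<rho> p - K p)" for p
  have KF: "K (F p) = \<rho> p" for p
    by (simp add: F_def linear_add[OF linK] R(2))
  define F' where "F' p = Blinfun (\<lambda>v. v + R (tmap \<rho> p v - K v))" for p
  have F': "blinfun_apply (F' p) = (\<lambda>v. v + R (tmap \<rho> p v - K v))" if "p \<in> P" for p
    unfolding F'_def
    by (intro bounded_linear_Blinfun_apply bounded_linear_add bounded_linear_ident
        bounded_linear_compose[OF bl(1)] bounded_linear_sub bl(2) has_derivative_bounded_linear[OF d\<rho>[OF that]])
  have derF: "(F has_derivative blinfun_apply (F' p)) (at p)" if "p \<in> P" for p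
    unfolding F'[OF that] unfolding F_def
    by (intro has_derivative_add has_derivative_ident bounded_linear.has_derivative[OF bl(1)]
        has_derivative_diff d\<rho>[OF that] bounded_linear_imp_has_derivative bl(2))
  \<comment> \<open>The inverse function theorem asks for a derivative that is continuous in
    operator norm; in finite dimension this can be tested on basis vectors.\<close>
  have contF': "continuous_on P F'"
  proof (rule continuous_on_blinfun_componentwise)
    fix e :: 'a
    have "continuous_on P (\<lambda>p. tmap \<rho> p e)"
      using smooth_on_tmap[OF assms(2), of e] unfolding smooth_on_def by (metis Ck_on.simps(1))
    then have "continuous_on P (\<lambda>p. e + R (tmap \<rho> p e - K e))"
      by (intro continuous_intros bounded_linear.continuous_on[OF bl(1)])
    then show "continuous_on P (\<lambda>p. blinfun_apply (F' p) e)"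
      by (rule continuous_on_eq) (simp add: F')
  qed
  have F'p0: "F' p0 = id_blinfun"
    using F'[OF assms(3)] by (intro blinfun_eqI) (simp add: K_def[symmetric] linear_0[OF R(1)])
  have inv: "id_blinfun o\<^sub>L F' p0 = id_blinfun"
    by (rule blinfun_eqI) (simp add: F'p0)
  obtain U V G G' where *: "open U" "U \<subseteq> P" "p0 \<in> U" "open V" "F p0 \<in> V" "homeomorphism U V F G"
    "\<And>y. y \<in> V \<Longrightarrow> (G has_derivative (G' y)) (at y)"
    "\<And>y. y \<in> V \<Longrightarrow> G' y = inv (blinfun_apply (F' (G y)))"
    using inverse_function_theorem[OF assms(1) derF contF' assms(3) inv] by metis
  show ?thesis
  proof (rule that[OF *(1,3,2,4)])
    show "continuous_on U F" using *(6) by (auto simp: homeomorphism_def)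
    show "F p \<in> V \<and> G (F p) = p \<and> tmap \<rho> p0 (F p) = \<rho> p" if "p \<in> U" for p
      using *(6) that KF by (auto simp: homeomorphism_def K_def)
    have FG: "G y \<in> U \<and> F (G y) = y" if "y \<in> V" for y
      using *(6) that by (auto simp: homeomorphism_def)
    show "G y \<in> U \<and> \<rho> (G y) = tmap \<rho> p0 y \<and> (G has_derivative G' y) (at y)" if "y \<in> V" for y
      using FG[OF that] KF[of "G y"] *(7)[OF that] by (auto simp: K_def)
    have "G (F p0) = p0" using *(3,6) by (auto simp: homeomorphism_def)
    moreover have "inv (\<lambda>x::'a. x) = (\<lambda>x. x)" using inv_id by (simp add: id_def)
    ultimately show "G' (F p0) v = v" for v
      using *(8)[OF *(5)] by (simp add: F'p0)
  qed
qed

text \<open>In the chart, the affine slice \<open>F p + R (y - \<rho> p)\<close> is a section of the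
  linear map \<open>tmap \<rho> p\<close>, since \<open>R\<close> is a right inverse of it. The
  inverse chart \<open>G\<close> carries this slice to a section of \<rho> through
  \<open>p\<close>.\<close>

lemma submersion_local_section:
  fixes \<rho> :: "'a::euclidean_space \<Rightarrow> 'b::euclidean_space"
  assumes "open P" "smooth_on P \<rho>" "p \<in> P" "surj (tmap \<rho> p)"
  obtains t t' N where "open N" "\<rho> p \<in> N" "t (\<rho> p) = p" "(t has_derivative t') (at (\<rho> p))"
    "\<And>y. y \<in> N \<Longrightarrow> t y \<in> P \<and> \<rho> (t y) = y"
proof -
  obtain U V F G G' where c: "open U" "p \<in> U" "U \<subseteq> P" "open V" "continuous_on U F"
    "\<And>x. x \<in> U \<Longrightarrow> F x \<in> V \<and> G (F x) = x \<and> tmap \<rho> p (F x) = \<rho> x"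
    "\<And>y. y \<in> V \<Longrightarrow> G y \<in> U \<and> \<rho> (G y) = tmap \<rho> p y \<and> (G has_derivative G' y) (at y)"
    using submersion_chart[OF assms] by metis
  have linK: "linear (tmap \<rho> p)"
    using smooth_on_has_derivative[OF assms(2,3)] by (rule has_derivative_linear)
  obtain R where R: "linear R" "\<And>x. tmap \<rho> p (R x) = x"
    using linear_surjective_right_inverse[OF linK assms(4)] by (auto simp: fun_eq_iff)
  have bl: "bounded_linear R" using R(1) by (simp add: linear_conv_bounded_linear)
  define x where "x y = F p + R (y - \<rho> p)" for y
  have xp: "x (\<rho> p) = F p" by (simp add: x_def linear_0[OF R(1)])
  have dx: "(x has_derivative R) (at y)" for y
    proof -
    have "((\<lambda>y. F p + R (y - \<rho> p)) has_derivative (\<lambda>v. 0 + R (v - 0))) (at y)"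
      by (intro has_derivative_add has_derivative_const bounded_linear.has_derivative[OF bl]
          has_derivative_diff has_derivative_ident)
    then show ?thesis by (simp add: x_def[abs_def])
  qed
  show ?thesis
  proof (rule that[of "x -` V" "\<lambda>y. G (x y)" "\<lambda>v. G' (x (\<rho> p)) (R v)"])
    have "continuous_on UNIV x"
      using dx by (meson continuous_at_imp_continuous_on has_derivative_continuous)
    then show "open (x -` V)" using c(4) by (simp add: continuous_on_open_vimage)
    show "\<rho> p \<in> x -` V" "G (x (\<rho> p)) = p" using c(2,6) by (auto simp: xp)
    show "((\<lambda>y. G (x y)) has_derivative (\<lambda>v. G' (x (\<rho> p)) (R v))) (at (\<rho> p))"
      by (rule has_derivative_compose[OF dx]) (use c(2,6,7) xp in auto)
    show "G (x y) \<in> P \<and> \<rho> (G (x y)) = y" if "y \<in> x -` V" for y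
    proof -
      have "tmap \<rho> p (x y) = y"
        using c(2,6) by (simp add: x_def linear_add[OF linK] R(2))
      then show ?thesis using c(3,7) that by auto
    qed
  qed
qed

section \<open>Functions along the fibres\<close>

text \<open>The curve \<open>G (F p + t *\<^sub>R v)\<close> stays in the fibre because
  \<open>v\<close> lies in the kernel of the linearized \<rho>, and its velocity at
  \<open>t = 0\<close> is \<open>v\<close>. The function does not change along it.\<close>

lemma derivative_zero_if_constant_on_fibre:
  fixes \<rho> :: "'a::euclidean_space \<Rightarrow> 'b::euclidean_space" and f :: "'a \<Rightarrow> real"
  assumes "open P" "smooth_on P \<rho>" "p \<in> P" "surj (tmap \<rho> p)"
    and f: "(f has_derivative f') (at p)" "\<And>x. x \<in> P \<Longrightarrow> \<rho> x = \<rho> p \<Longrightarrow> f x = f p"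
    and v: "tmap \<rho> p v = 0"
  shows "f' v = 0"
proof -
  obtain U V F G G' where c: "open U" "p \<in> U" "U \<subseteq> P" "open V" "continuous_on U F"
    "\<And>x. x \<in> U \<Longrightarrow> F x \<in> V \<and> G (F x) = x \<and> tmap \<rho> p (F x) = \<rho> x"
    "\<And>y. y \<in> V \<Longrightarrow> G y \<in> U \<and> \<rho> (G y) = tmap \<rho> p y \<and> (G has_derivative G' y) (at y)"
    "\<And>v. G' (F p) v = v"
    using submersion_chart[OF assms(1-4)] by blast
  have linK: "linear (tmap \<rho> p)"
    using smooth_on_has_derivative[OF assms(2,3)] by (rule has_derivative_linear)
  define x where "x t = F p + t *\<^sub>R v" for t :: real
  have dx: "(x has_derivative (\<lambda>r. r *\<^sub>R v)) (at t)" for t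
    unfolding x_def by (auto intro!: derivative_eq_intros)
  have x0: "x 0 = F p" by (simp add: x_def)
  have "(G has_derivative G' (x 0)) (at (x 0))" using c(2,6,7) x0 by auto
  from has_derivative_compose[OF dx this]
  have "((\<lambda>t. G (x t)) has_derivative (\<lambda>r. r *\<^sub>R v)) (at 0)"
    by (simp add: x0 c(8))
  moreover have "(f has_derivative f') (at (G (x 0)))" using f(1) c(2,6) x0 by auto
  ultimately have *: "((\<lambda>t. f (G (x t))) has_derivative (\<lambda>r. f' (r *\<^sub>R v))) (at 0)"
    by (rule has_derivative_compose)
  have "((\<lambda>t. f p) has_derivative (\<lambda>r. f' (r *\<^sub>R v))) (at (0::real))"
  proof (rule has_derivative_transform_within_open[OF *])
    have "continuous_on UNIV x"
      using dx by (meson continuous_at_imp_continuous_on has_derivative_continuous)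
    then show "open (x -` V)" using c(4) by (simp add: continuous_on_open_vimage)
    show "0 \<in> x -` V" using c(2,6) by (simp add: x0)
    show "f (G (x t)) = f p" if "t \<in> x -` V" for t
    proof (rule f(2))
      show "G (x t) \<in> P" using that c(3,7) by auto
      have "tmap \<rho> p (x t) = \<rho> p"
        using c(2,6) v by (simp add: x_def linear_add[OF linK] linear_scale[OF linK])
      then show "\<rho> (G (x t)) = \<rho> p" using that c(7) by auto
    qed
  qed
  then have "(\<lambda>r. f' (r *\<^sub>R v)) = (\<lambda>r. 0)"
    using has_derivative_unique has_derivative_const by blast
  then show ?thesis by (metis scaleR_one)
qed

text \<open>On a connected set local constancy suffices. Near a point the fibre is flat in the
  chart, so neighbouring points are joined by a segment that the inverse chart maps into the fibre,
  and the mean value theorem applies along it.\<close>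

lemma constant_on_connected_fibre:
  fixes \<rho> :: "'a::euclidean_space \<Rightarrow> 'b::euclidean_space" and f :: "'a \<Rightarrow> real"
  assumes "open P" "smooth_on P \<rho>" "\<And>p. p \<in> P \<Longrightarrow> surj (tmap \<rho> p)"
    and "connected {p \<in> P. \<rho> p = q}"
    and f: "\<And>p. p \<in> P \<Longrightarrow> \<rho> p = q \<Longrightarrow> (f has_derivative f' p) (at p)"
      "\<And>p v. p \<in> P \<Longrightarrow> \<rho> p = q \<Longrightarrow> tmap \<rho> p v = 0 \<Longrightarrow> f' p v = 0"
    and ab: "a \<in> P" "\<rho> a = q" "b \<in> P" "\<rho> b = q"
  shows "f a = f b"
proof (rule connected_local_const[OF assms(4)])
  show "a \<in> {p \<in> P. \<rho> p = q}" "b \<in> {p \<in> P. \<rho> p = q}" using ab by auto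
  show "\<forall>a\<in>{p \<in> P. \<rho> p = q}. \<forall>\<^sub>F b in at a within {p \<in> P. \<rho> p = q}. f a = f b"
  proof
    fix a assume "a \<in> {p \<in> P. \<rho> p = q}"
    then have a: "a \<in> P" "\<rho> a = q" by auto
    obtain U V F G G' where c: "open U" "a \<in> U" "U \<subseteq> P" "open V" "continuous_on U F"
      "\<And>x. x \<in> U \<Longrightarrow> F x \<in> V \<and> G (F x) = x \<and> tmap \<rho> a (F x) = \<rho> x"
      "\<And>y. y \<in> V \<Longrightarrow> G y \<in> U \<and> \<rho> (G y) = tmap \<rho> a y \<and> (G has_derivative G' y) (at y)"
      using submersion_chart[OF assms(1,2) a(1) assms(3)[OF a(1)]] by metis
    have dK: "(tmap \<rho> a has_derivative tmap \<rho> a) (at y)" for y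
      using smooth_on_has_derivative[OF assms(2) a(1)]
      by (intro bounded_linear_imp_has_derivative has_derivative_bounded_linear)
    have linK: "linear (tmap \<rho> a)"
      using smooth_on_has_derivative[OF assms(2) a(1)] by (rule has_derivative_linear)
    \<comment> \<open>A ball, because its convexity keeps the segments inside the chart
      domain.\<close>
    obtain r where r: "r > 0" "ball (F a) r \<subseteq> V" using c(2,4,6) openE by blast
    have "f a = f b" if b: "b \<in> U \<inter> F -` ball (F a) r" "\<rho> b = q" for b
    proof -
      define d where "d = F b - F a"
      have Kd: "tmap \<rho> a d = 0"
        using b c(2,6) a by (simp add: d_def linear_diff[OF linK])
      define x where "x t = F a + t *\<^sub>R d" for t :: real
      have dx: "(x has_derivative (\<lambda>r. r *\<^sub>R d)) (at t)" for t
        unfolding x_def by (auto intro!: derivative_eq_intros)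
      have xV: "x t \<in> V" if "0 \<le> t" "t \<le> 1" for t
      proof -
        have "x t = (1 - t) *\<^sub>R F a + t *\<^sub>R F b" by (simp add: x_def d_def algebra_simps)
        moreover have "(1 - t) *\<^sub>R F a + t *\<^sub>R F b \<in> ball (F a) r"
          using that b r(1) by (intro convexD[OF convex_ball]) auto
        ultimately show ?thesis using r(2) by auto
      qed
      have "((\<lambda>t. f (G (x t))) has_real_derivative 0) (at t)" if "0 \<le> t" "t \<le> 1" for t
      proof -
        have V: "x t \<in> V" using xV that by blast
        have p: "G (x t) \<in> P" using c(3) c(7)[OF V] by auto
        have q: "\<rho> (G (x t)) = q"
          using c(7)[OF V] c(6)[OF c(2)] Kd a(2)
          by (simp add: x_def linear_add[OF linK] linear_scale[OF linK])
        have dG: "(G has_derivative G' (x t)) (at (x t))" using c(7)[OF V] by blast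
        \<comment> \<open>Differentiating \<open>\<rho> (G y) = tmap \<rho> a y\<close> shows that
          \<open>G'\<close> sends the kernel of \<open>tmap \<rho> a\<close> to vertical vectors at
          every point of the segment, not only at \<open>a\<close>.\<close>
        have "((\<lambda>y. \<rho> (G y)) has_derivative (\<lambda>v. tmap \<rho> (G (x t)) (G' (x t) v))) (at (x t))"
          by (rule has_derivative_compose[OF dG smooth_on_has_derivative[OF assms(2) p]])
        then have "(tmap \<rho> a has_derivative (\<lambda>v. tmap \<rho> (G (x t)) (G' (x t) v))) (at (x t))"
          by (rule has_derivative_transform_within_open[OF _ c(4) V]) (use c(7) in auto)
        then have "tmap \<rho> a = (\<lambda>v. tmap \<rho> (G (x t)) (G' (x t) v))"
          by (rule has_derivative_unique[OF dK])
        then have "tmap \<rho> (G (x t)) (G' (x t) (r *\<^sub>R d)) = 0" for r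
          using Kd linear_scale[OF linK] by (metis scaleR_zero_right)
        then have "(\<lambda>r. f' (G (x t)) (G' (x t) (r *\<^sub>R d))) = (*) 0"
          using f(2)[OF p q] by (simp add: fun_eq_iff)
        moreover have "((\<lambda>t. f (G (x t))) has_derivative (\<lambda>r. f' (G (x t)) (G' (x t) (r *\<^sub>R d)))) (at t)"
          by (rule has_derivative_compose[OF has_derivative_compose[OF dx dG] f(1)[OF p q]])
        ultimately show ?thesis unfolding has_field_derivative_def by metis
      qed
      then have "f (G (x 1)) - f (G (x 0)) = 0"
        using MVT2[of 0 1 "\<lambda>t. f (G (x t))" "\<lambda>_. 0"] by auto
      moreover have "G (x 1) = b" "G (x 0) = a" using b c(2,6) by (auto simp: x_def d_def)
      ultimately show ?thesis by simp
    qed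
    moreover have "open (U \<inter> F -` ball (F a) r)"
      using c(1,5) by (simp add: continuous_open_preimage)
    moreover have "a \<in> U \<inter> F -` ball (F a) r" using c(2) r(1) by simp
    ultimately show "\<forall>\<^sub>F b in at a within {p \<in> P. \<rho> p = q}. f a = f b"
      unfolding eventually_at_topological by blast
  qed
qed

section \<open>Forms and functions that descend along a submersion\<close>

text \<open>With \<open>J\<close> the Jacobian of \<rho>, the matrix \<open>A\<close> is the product
  of \<open>J\<close> with its transpose, and the transpose of \<open>J\<close> times the inverse of
  \<open>A\<close> is a right inverse of \<open>J\<close> depending smoothly on the point. The
  fields \<open>r i\<close> are its columns.\<close>

lemma smooth_right_inverse:
  fixes \<rho> :: "'a::euclidean_space \<Rightarrow> real^'n"
  assumes "open P" "smooth_on P \<rho>" "\<And>p. p \<in> P \<Longrightarrow> surj (tmap \<rho> p)"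
  obtains r :: "'n \<Rightarrow> 'a \<Rightarrow> 'a" where "\<And>i. smooth_on P (r i)"
    "\<And>p i. p \<in> P \<Longrightarrow> tmap \<rho> p (r i p) = axis i 1"
proof -
  define A :: "'a \<Rightarrow> real^'n^'n" where
    "A p = (\<chi> i j. \<Sum>e\<in>Basis. tmap \<rho> p e $ i * tmap \<rho> p e $ j)" for p
  have lin: "linear (tmap \<rho> p)" if "p \<in> P" for p
    using smooth_on_has_derivative[OF assms(2) that] by (rule has_derivative_linear)
  have mult_A: "A p *v x = (\<Sum>e\<in>Basis. (tmap \<rho> p e \<bullet> x) *\<^sub>R tmap \<rho> p e)" for p x
  proof -
    have "(\<Sum>j\<in>UNIV. (\<Sum>e\<in>Basis. tmap \<rho> p e $ i * tmap \<rho> p e $ j) * x $ j)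
        = (\<Sum>e\<in>Basis. (\<Sum>j\<in>UNIV. tmap \<rho> p e $ j * x $ j) * tmap \<rho> p e $ i)" for i
      unfolding sum_distrib_right
      by (subst sum.swap) (simp add: mult_ac)
    then show ?thesis
      by (simp add: vec_eq_iff A_def matrix_vector_mult_def inner_vec_def)
  qed
  have det: "det (A p) \<noteq> 0" if p: "p \<in> P" for p
  proof -
    have "x = 0" if "A p *v x = 0" for x
    proof -
      \<comment> \<open>The quadratic form of \<open>A\<close> is a sum of squares, so a kernel
        vector is orthogonal to the image of \<open>tmap \<rho> p\<close>, which is the whole
        space.\<close>
      have "(\<Sum>e\<in>Basis. (tmap \<rho> p e \<bullet> x)\<^sup>2) = x \<bullet> (A p *v x)"
        by (simp add: mult_A inner_sum_right power2_eq_square inner_commute)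
      then have 0: "tmap \<rho> p e \<bullet> x = 0" if "e \<in> Basis" for e
        using \<open>A p *v x = 0\<close> that by (simp add: sum_nonneg_eq_0_iff)
      obtain u where "tmap \<rho> p u = x" using assms(3)[OF p] by (metis surjD)
      then have "x \<bullet> x = (\<Sum>e\<in>Basis. (u \<bullet> e) *\<^sub>R tmap \<rho> p e) \<bullet> x"
        using linear_expand_basis[OF lin[OF p]] by metis
      also have "\<dots> = 0" using 0 by (simp add: inner_sum_left)
      finally show ?thesis by simp
    qed
    then show ?thesis
      using matrix_left_invertible_ker invertible_det_nz invertible_left_inverse by blast
  qed
  \<comment> \<open>Cramer's rule: the columns of the inverse of \<open>A\<close> as quotients of
    determinants, whose smoothness is visible.\<close>
  define y :: "'n \<Rightarrow> 'a \<Rightarrow> 'n \<Rightarrow> real" where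
    "y i p k = det (\<chi> a b. if b = k then axis i 1 $ a else A p $ a $ b) * inverse (det (A p))" for i p k
  have Ay: "A p *v (\<chi> k. y i p k) = axis i 1" if "p \<in> P" for p i
    using cramer[OF det[OF that], of "\<chi> k. y i p k" "axis i 1"] by (simp add: y_def divide_inverse)
  define r where "r i p = (\<Sum>e\<in>Basis. (\<Sum>j\<in>UNIV. tmap \<rho> p e $ j * y i p j) *\<^sub>R e)" for i p
  show ?thesis
  proof
    show "tmap \<rho> p (r i p) = axis i 1" if "p \<in> P" for p i
      using Ay[OF that, of i]
      by (simp add: mult_A r_def linear_sum[OF lin[OF that]] linear_scale[OF lin[OF that]] inner_vec_def)
    have CD: "Ck_on k P (\<lambda>p. tmap \<rho> p e $ j)" for k e j
      using smooth_on_tmap[OF assms(2), of e]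
      by (intro Ck_on_linear[OF assms(1) bounded_linear_vec_nth]) (simp add: smooth_on_def)
    have CA: "Ck_on k P (\<lambda>p. A p $ a $ b)" for k a b
      by (simp add: A_def) (intro Ck_on_sum Ck_on_mult CD assms(1))
    have Cy: "Ck_on k P (\<lambda>p. y i p j)" for k i j
      unfolding y_def
    proof (intro Ck_on_mult Ck_on_inverse Ck_on_det assms(1) det CA)
      show "Ck_on k P (\<lambda>p. (\<chi> a b. if b = j then axis i 1 $ a else A p $ a $ b) $ a $ b)" for a b
        by (cases "b = j") (simp_all add: Ck_on_const CA)
    qed
    show "smooth_on P (r i)" for i
      unfolding smooth_on_def r_def
      by (intro allI Ck_on_sum Ck_on_scaleR Ck_on_mult Ck_on_const CD Cy assms(1))
  qed
qed

text \<open>Subtracting from \<open>u\<close> the lift of \<open>tmap \<rho> p u\<close> by the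
  fields \<open>r i\<close> leaves a vertical vector, which the form kills. The coefficient
  \<open>b\<close> is a covector of the target but may still vary along the fibre.\<close>

lemma form_factors_through_submersion:
  fixes \<rho> :: "'a::euclidean_space \<Rightarrow> real^'n"
  assumes "open P" "smooth_on P \<rho>" "\<And>p. p \<in> P \<Longrightarrow> surj (tmap \<rho> p)" "smooth_on P \<omega>"
    and "\<And>p v. p \<in> P \<Longrightarrow> tmap \<rho> p v = 0 \<Longrightarrow> \<omega> p \<bullet> v = 0"
  obtains b where "smooth_on P b" "\<And>p u. p \<in> P \<Longrightarrow> \<omega> p \<bullet> u = b p \<bullet> tmap \<rho> p u"
proof -
  obtain r :: "'n \<Rightarrow> 'a \<Rightarrow> 'a" where r: "\<And>i. smooth_on P (r i)"
    "\<And>p i. p \<in> P \<Longrightarrow> tmap \<rho> p (r i p) = axis i 1"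
    using smooth_right_inverse[OF assms(1-3)] by blast
  define b where "b p = (\<Sum>i\<in>UNIV. (\<omega> p \<bullet> r i p) *\<^sub>R (axis i 1 :: real^'n))" for p
  show ?thesis
  proof
    show "smooth_on P b"
      unfolding b_def smooth_on_def using assms(4) r(1)
      by (intro allI Ck_on_sum Ck_on_scaleR Ck_on_inner Ck_on_const assms(1)) (auto simp: smooth_on_def)
    show "\<omega> p \<bullet> u = b p \<bullet> tmap \<rho> p u" if "p \<in> P" for p u
    proof -
      have lin: "linear (tmap \<rho> p)"
        using smooth_on_has_derivative[OF assms(2) that] by (rule has_derivative_linear)
      have "(\<Sum>i\<in>UNIV. tmap \<rho> p u $ i *\<^sub>R axis i 1) = tmap \<rho> p u"
        by (rule basis_expansion[where 'a = real, unfolded scalar_mult_eq_scaleR])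
      then have "tmap \<rho> p (u - (\<Sum>i\<in>UNIV. (tmap \<rho> p u $ i) *\<^sub>R r i p)) = 0"
        by (simp add: linear_diff[OF lin] linear_sum[OF lin] linear_scale[OF lin] r(2)[OF that])
      from assms(5)[OF that this] show ?thesis
        by (simp add: b_def inner_diff_right inner_sum_right inner_sum_left inner_axis' mult.commute)
    qed
  qed
qed

text \<open>Near a point, \<open>f\<close> is the composite of \<open>f \<circ> \<rho>\<close> with
  a local section, which gives continuity and differentiability. Higher orders come by induction,
  since the derivatives of \<open>f\<close>, pulled back to \<open>P\<close>, are derivatives of
  \<open>f \<circ> \<rho>\<close> along lifted vectors.\<close>

lemma Ck_on_descend:
  fixes \<rho> :: "'a::euclidean_space \<Rightarrow> real^'n" and f :: "real^'n \<Rightarrow> 'c::real_normed_vector"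
  assumes "open P" "smooth_on P \<rho>" "\<And>p. p \<in> P \<Longrightarrow> surj (tmap \<rho> p)"
    and "open V" "V \<subseteq> \<rho> ` P"
    and "Ck_on n {p \<in> P. \<rho> p \<in> V} (\<lambda>p. f (\<rho> p))"
  shows "Ck_on n V f"
proof -
  have "continuous_on P \<rho>"
    using assms(2) unfolding smooth_on_def by (metis Ck_on.simps(1))
  then have W: "open {p \<in> P. \<rho> p \<in> V}"
    using continuous_open_preimage[of P \<rho> V] assms(1,4) by (simp add: vimage_def Int_def)
  show ?thesis
    using assms(6)
  proof (induction n arbitrary: f)
    case 0
    have "isCont f q" if q: "q \<in> V" for q
    proof -
      obtain p where p: "p \<in> P" "\<rho> p = q" using q assms(5) by blast
      obtain N t t' where t: "open N" "\<rho> p \<in> N" "t (\<rho> p) = p" "(t has_derivative t') (at (\<rho> p))"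
        "\<And>y. y \<in> N \<Longrightarrow> t y \<in> P \<and> \<rho> (t y) = y"
        using submersion_local_section[OF assms(1,2) p(1) assms(3)[OF p(1)]] by metis
      have "isCont t q" using has_derivative_continuous[OF t(4)] p by simp
      moreover have "isCont (\<lambda>p. f (\<rho> p)) (t q)"
        using 0 W q t(3) p by (simp add: continuous_on_eq_continuous_at)
      ultimately have "isCont (\<lambda>y. f (\<rho> (t y))) q" by (rule isCont_o2)
      moreover have "\<forall>\<^sub>F y in nhds q. f (\<rho> (t y)) = f y"
        using t(1,2,5) p(2) unfolding eventually_nhds by metis
      then have "isCont (\<lambda>y. f (\<rho> (t y))) q \<longleftrightarrow> isCont f q" by (rule isCont_cong)
      ultimately show ?thesis by simp
    qed
    then show ?case
      by (simp add: continuous_at_imp_continuous_on)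
  next
    case (Suc n)
    let ?h = "\<lambda>p. f (\<rho> p)"
    have dh: "(?h has_derivative tmap ?h p) (at p)" if "p \<in> P" "\<rho> p \<in> V" for p
      using Ck_on_SucD[OF Suc.prems] that by simp
    have df: "(f has_derivative tmap f q) (at q)" if q: "q \<in> V" for q
    proof -
      obtain p where p: "p \<in> P" "\<rho> p = q" using q assms(5) by blast
      obtain N t t' where t: "open N" "\<rho> p \<in> N" "t (\<rho> p) = p" "(t has_derivative t') (at (\<rho> p))"
        "\<And>y. y \<in> N \<Longrightarrow> t y \<in> P \<and> \<rho> (t y) = y"
        using submersion_local_section[OF assms(1,2) p(1) assms(3)[OF p(1)]] by metis
      have "(?h has_derivative tmap ?h p) (at (t (\<rho> p)))" using dh p q t(3) by simp
      from has_derivative_compose[OF t(4) this]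
      have "(f has_derivative (\<lambda>v. tmap ?h p (t' v))) (at (\<rho> p))"
        by (rule has_derivative_transform_within_open[OF _ t(1,2)]) (simp add: t(5))
      then show ?thesis
        using p(2) frechet_derivative_works by (auto simp: differentiable_def)
    qed
    show ?case
      unfolding Ck_on.simps
    proof (intro conjI ballI allI)
      show "f differentiable (at q)" if "q \<in> V" for q
        using df[OF that] by (auto simp: differentiable_def)
      fix v
      obtain r :: "'n \<Rightarrow> 'a \<Rightarrow> 'a" where r: "\<And>i. smooth_on P (r i)"
        "\<And>p i. p \<in> P \<Longrightarrow> tmap \<rho> p (r i p) = axis i 1"
        using smooth_right_inverse[OF assms(1-3)] by blast
      \<comment> \<open>The left side differentiates \<open>f \<circ> \<rho>\<close> along the lift
        of \<open>v\<close> with coefficients \<open>v $ i\<close> in the fields \<open>r i\<close>.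
        It uses only derivatives in constant directions, hence is visibly of class C^n.\<close>
      have "(\<Sum>i\<in>UNIV. v $ i *\<^sub>R (\<Sum>e\<in>Basis. (r i p \<bullet> e) *\<^sub>R tmap ?h p e)) = tmap f (\<rho> p) v"
        if p: "p \<in> P" "\<rho> p \<in> V" for p
      proof -
        have "tmap ?h p = (\<lambda>u. tmap f (\<rho> p) (tmap \<rho> p u))"
          by (rule has_derivative_unique[OF dh[OF p] has_derivative_compose[OF
                  smooth_on_has_derivative[OF assms(2) p(1)] df[OF p(2)]]])
        then have "(\<Sum>e\<in>Basis. (r i p \<bullet> e) *\<^sub>R tmap ?h p e) = tmap f (\<rho> p) (axis i 1)" for i
          using linear_expand_basis[OF has_derivative_linear[OF dh[OF p]], of "r i p"] r(2)[OF p(1)]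
          by metis
        moreover have lin: "linear (tmap f (\<rho> p))" using df[OF p(2)] by (rule has_derivative_linear)
        ultimately have "(\<Sum>i\<in>UNIV. v $ i *\<^sub>R (\<Sum>e\<in>Basis. (r i p \<bullet> e) *\<^sub>R tmap ?h p e))
            = tmap f (\<rho> p) (\<Sum>i\<in>UNIV. v $ i *\<^sub>R axis i 1)"
          by (simp add: linear_sum[OF lin] linear_scale[OF lin])
        also have "(\<Sum>i\<in>UNIV. v $ i *\<^sub>R axis i 1) = v"
          by (rule basis_expansion[where 'a = real, unfolded scalar_mult_eq_scaleR])
        finally show ?thesis .
      qed
      moreover have "Ck_on n {p \<in> P. \<rho> p \<in> V}
          (\<lambda>p. \<Sum>i\<in>UNIV. v $ i *\<^sub>R (\<Sum>e\<in>Basis. (r i p \<bullet> e) *\<^sub>R tmap ?h p e))"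
      proof -
        have "Ck_on n {p \<in> P. \<rho> p \<in> V} (r i)" for i
          using r(1) by (auto simp: smooth_on_def intro: Ck_on_subset)
        moreover have "Ck_on n {p \<in> P. \<rho> p \<in> V} (\<lambda>p. tmap ?h p e)" for e
          using Suc.prems by simp
        ultimately show ?thesis
          by (intro Ck_on_sum[OF W] Ck_on_scaleR[OF W] Ck_on_inner[OF W] Ck_on_const)
      qed
      ultimately have "Ck_on n {p \<in> P. \<rho> p \<in> V} (\<lambda>p. tmap f (\<rho> p) v)"
        by (intro Ck_on_cong[OF W, of _ "\<lambda>p. tmap f (\<rho> p) v"]) auto
      then show "Ck_on n V (\<lambda>q. tmap f q v)"
        by (rule Suc.IH)
    qed
  qed
qed

text \<open>Differentiating the factorization gives a term with the second derivative of \<rho>,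
  which is symmetric and cancels in \<open>ext_d\<close>. The derivative of \<open>b\<close> along
  \<open>u\<close> is paired with \<open>tmap \<rho> p v = 0\<close>, so only the derivative along
  the fibre remains.\<close>

lemma ext_d_factored_form:
  fixes \<rho> :: "'a::euclidean_space \<Rightarrow> 'b::euclidean_space"
  assumes "open P" "smooth_on P \<rho>" "smooth_on P \<omega>" "smooth_on P b"
    and "\<And>p u. p \<in> P \<Longrightarrow> \<omega> p \<bullet> u = b p \<bullet> tmap \<rho> p u"
    and "p \<in> P" "tmap \<rho> p v = 0"
  shows "ext_d \<omega> p v u = tmap b p v \<bullet> tmap \<rho> p u"
proof -
  have "tmap \<omega> p v \<bullet> u = b p \<bullet> tmap (\<lambda>y. tmap \<rho> y u) p v + tmap b p v \<bullet> tmap \<rho> p u" for u v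
  proof -
    have "((\<lambda>y. \<omega> y \<bullet> u) has_derivative (\<lambda>v. tmap \<omega> p v \<bullet> u)) (at p)"
      by (intro has_derivative_inner_left smooth_on_has_derivative[OF assms(3,6)])
    moreover have "((\<lambda>y. b y \<bullet> tmap \<rho> y u) has_derivative
        (\<lambda>v. b p \<bullet> tmap (\<lambda>y. tmap \<rho> y u) p v + tmap b p v \<bullet> tmap \<rho> p u)) (at p)"
      by (intro has_derivative_inner smooth_on_has_derivative[of P] smooth_on_tmap assms)
    then have "((\<lambda>y. \<omega> y \<bullet> u) has_derivative
        (\<lambda>v. b p \<bullet> tmap (\<lambda>y. tmap \<rho> y u) p v + tmap b p v \<bullet> tmap \<rho> p u)) (at p)"
      by (rule has_derivative_transform_within_open[OF _ assms(1,6)]) (simp add: assms(5))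
    ultimately show ?thesis
      by (rule fun_cong[OF has_derivative_unique])
  qed
  then show ?thesis
    using symmetric_second_derivative[OF assms(1,2,6), of u v] assms(7) by (simp add: ext_d_def)
qed

section \<open>The structure equations along a section\<close>

lemma exhaust_5:
  fixes x :: 5
  shows "x = 1 \<or> x = 2 \<or> x = 3 \<or> x = 4 \<or> x = 5"
proof (induct x)
  case (of_int z)
  \<comment> \<open>The representatives run from 0 to 4; the element 0 of this type is also written
    5.\<close>
  then have "z = 0 \<or> z = 1 \<or> z = 2 \<or> z = 3 \<or> z = 4" by fastforce
  then show ?case by auto
qed

lemma forall_5: "(\<forall>i::5. P i) \<longleftrightarrow> P 1 \<and> P 2 \<and> P 3 \<and> P 4 \<and> P 5"
  by (metis exhaust_5)

lemma UNIV_5: "UNIV = {1, 2, 3, 4, 5 :: 5}"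
  using exhaust_5 by auto

lemma sum_5: "sum f (UNIV :: 5 set) = f 1 + f 2 + f 3 + f 4 + f 5"
  unfolding UNIV_5 by (simp add: ac_simps)

lemma theta_simps:
  "theta 0 u = u $ 2" "theta (Suc 0) u = u $ 3" "theta 1 u = u $ 3" "theta 2 u = u $ 4" "theta 3 u = u $ 5"
  by (simp_all add: theta_def)

lemma matrix_mult_row: "(A ** B) $ i = (\<Sum>k\<in>UNIV. A $ i $ k *\<^sub>R B $ k)"
  for A :: "real^'m^'k" and B :: "real^'n^'m"
  by (simp add: vec_eq_iff matrix_matrix_mult_def)

lemma diag5_rows:
  "(diag5 d1 d2 d3 d4 d5 ** X) $ 1 = d1 *\<^sub>R X $ 1"
  "(diag5 d1 d2 d3 d4 d5 ** X) $ 2 = d2 *\<^sub>R X $ 2"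
  "(diag5 d1 d2 d3 d4 d5 ** X) $ 3 = d3 *\<^sub>R X $ 3"
  "(diag5 d1 d2 d3 d4 d5 ** X) $ 4 = d4 *\<^sub>R X $ 4"
  "(diag5 d1 d2 d3 d4 d5 ** X) $ 5 = d5 *\<^sub>R X $ 5"
  by (simp_all add: matrix_mult_row diag5_def sum_5)

lemma lower5_rows:
  "(lower5 c ** X) $ 1 = 0" "(lower5 c ** X) $ 2 = 0" "(lower5 c ** X) $ 3 = c *\<^sub>R X $ 2"
  "(lower5 c ** X) $ 4 = (4/3 * c) *\<^sub>R X $ 3" "(lower5 c ** X) $ 5 = c *\<^sub>R X $ 4"
  by (simp_all add: matrix_mult_row lower5_def sum_5)

text \<open>The matrix \<open>lower5 c\<close> shifts rows 2, 3, 4 down by one and kills the rest,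
  so its fourth power is zero and the exponential series stops.\<close>

lemma matrix_exp_lower5:
  "matrix_exp (lower5 c) = (\<Sum>k<4. (1 / fact k) *\<^sub>R ((\<lambda>B. lower5 c ** B) ^^ k) (mat 1))"
  unfolding matrix_exp_def
proof (rule suminf_finite)
  fix k :: nat assume "k \<notin> {..<4}"
  then obtain j where "k = 4 + j" by (metis le_Suc_ex lessThan_iff not_less)
  moreover have "((\<lambda>B. lower5 c ** B) ^^ 4) X = 0" for X
  proof -
    have "((\<lambda>B. lower5 c ** B) ^^ 4) X = lower5 c ** (lower5 c ** (lower5 c ** (lower5 c ** X)))"
      by (simp add: eval_nat_numeral)
    also have "\<dots> = 0"
      by (subst vec_eq_iff) (simp add: forall_5 lower5_rows)
    finally show ?thesis .
  qed
  ultimately show "(1 / fact k) *\<^sub>R ((\<lambda>B. lower5 c ** B) ^^ k) (mat 1) = 0"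
    by (simp add: funpow_add)
qed simp

text \<open>The coefficients are those of the cubic exponential: 2/3 is 4/3 divided by 2!, and 2/9
  is 4/3 divided by 3!. The explicit rows make the dependence on the group parameters differentiable
  by inspection.\<close>

lemma G1_elt_rows:
  "(G1_elt a b c ** u) $ 1 = a *\<^sub>R u $ 1"
  "(G1_elt a b c ** u) $ 2 = b *\<^sub>R u $ 2"
  "(G1_elt a b c ** u) $ 3 = (b / a) *\<^sub>R (u $ 3 + c *\<^sub>R u $ 2)"
  "(G1_elt a b c ** u) $ 4 = (b / a^2) *\<^sub>R (u $ 4 + (4/3 * c) *\<^sub>R u $ 3 + (2/3 * c^2) *\<^sub>R u $ 2)"
  "(G1_elt a b c ** u) $ 5 = (b / a^3) *\<^sub>R (u $ 5 + c *\<^sub>R u $ 4 + (2/3 * c^2) *\<^sub>R u $ 3 + (2/9 * c^3) *\<^sub>R u $ 2)"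
proof -
  have E: "matrix_exp (lower5 c) ** u = u + lower5 c ** u + (1/2) *\<^sub>R (lower5 c ** (lower5 c ** u))
      + (1/6) *\<^sub>R (lower5 c ** (lower5 c ** (lower5 c ** u)))"
  proof -
    have add: "(A + B) ** u = A ** u + B ** u" and scale: "(r *\<^sub>R A) ** u = r *\<^sub>R (A ** u)" for A B :: "real^5^5" and r
      by (simp_all add: vec_eq_iff matrix_matrix_mult_def algebra_simps sum.distrib sum_distrib_left)
    have "matrix_exp (lower5 c) = mat 1 + lower5 c ** mat 1 + (1/2) *\<^sub>R (lower5 c ** (lower5 c ** mat 1))
        + (1/6) *\<^sub>R (lower5 c ** (lower5 c ** (lower5 c ** mat 1)))"
      unfolding matrix_exp_lower5 by (simp add: eval_nat_numeral)
    then show ?thesis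
      by (simp only: add scale matrix_mul_assoc[symmetric] matrix_mul_lid)
  qed
  show "(G1_elt a b c ** u) $ 1 = a *\<^sub>R u $ 1"
    "(G1_elt a b c ** u) $ 2 = b *\<^sub>R u $ 2"
    "(G1_elt a b c ** u) $ 3 = (b / a) *\<^sub>R (u $ 3 + c *\<^sub>R u $ 2)"
    "(G1_elt a b c ** u) $ 4 = (b / a^2) *\<^sub>R (u $ 4 + (4/3 * c) *\<^sub>R u $ 3 + (2/3 * c^2) *\<^sub>R u $ 2)"
    "(G1_elt a b c ** u) $ 5 = (b / a^3) *\<^sub>R (u $ 5 + c *\<^sub>R u $ 4 + (2/3 * c^2) *\<^sub>R u $ 3 + (2/9 * c^3) *\<^sub>R u $ 2)"
    unfolding G1_elt_def matrix_mul_assoc[symmetric] diag5_rows E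
    by (simp_all add: lower5_rows power2_eq_square power3_eq_cube)
qed

section \<open>Trivializations of the bundle and pulled-back tautological forms\<close>

lemma triv_unit: "triv s (p, 1, 1, 0) = (p, s p)"
  by (simp add: triv_def vec_eq_iff[of "G1_elt 1 1 0 ** s p"] forall_5 G1_elt_rows)

lemma open_triv_dom: "open U \<Longrightarrow> open (triv_dom U)"
proof -
  assume "open U"
  have "triv_dom U = U \<times> (- {0}) \<times> (- {0}) \<times> UNIV"
    by (auto simp: triv_dom_def)
  then show ?thesis
    using \<open>open U\<close> by (simp add: open_Times open_Compl)
qed

lemma differentiable_row: "f differentiable F \<Longrightarrow> (\<lambda>x. f x $ i) differentiable F"
  unfolding differentiable_def by (blast intro: bounded_linear.has_derivative[OF bounded_linear_vec_nth])

lemma differentiable_Pair: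
  "f differentiable (at x within S) \<Longrightarrow> g differentiable (at x within S) \<Longrightarrow>
    (\<lambda>x. (f x, g x)) differentiable (at x within S)"
  unfolding differentiable_def by (blast intro: has_derivative_Pair)

lemma triv_row_differentiable:
  assumes "z \<in> triv_dom U" "\<forall>p\<in>U. s differentiable (at p)"
  shows "(\<lambda>z. snd (triv s z) $ i) differentiable (at z)"
proof -
  obtain p a b c where z: "z = (p, a, b, c)" "p \<in> U" "a \<noteq> 0"
    using assms(1) by (auto simp: triv_dom_def)
  have bl: "(\<lambda>z::(real^5) \<times> real \<times> real \<times> real. fst z) differentiable (at z)"
    "(\<lambda>z::(real^5) \<times> real \<times> real \<times> real. fst (snd z)) differentiable (at z)"
    "(\<lambda>z::(real^5) \<times> real \<times> real \<times> real. fst (snd (snd z))) differentiable (at z)"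
    "(\<lambda>z::(real^5) \<times> real \<times> real \<times> real. snd (snd (snd z))) differentiable (at z)"
    by (intro bounded_linear_imp_differentiable bounded_linear_intros)+
  have row: "(\<lambda>z::(real^5) \<times> real \<times> real \<times> real. s (fst z) $ i) differentiable (at z)" for i
  proof -
    have "(\<lambda>p. s p $ i) differentiable (at (fst z))"
      using differentiable_row[OF bspec[OF assms(2) z(2)]] z(1) by simp
    from differentiable_compose[OF this bl(1)] show ?thesis .
  qed
  have tr: "snd (triv s z) = G1_elt (fst (snd z)) (fst (snd (snd z))) (snd (snd (snd z))) ** s (fst z)" for z
    by (simp add: triv_def case_prod_beta)
  have i: "i = 1 \<or> i = 2 \<or> i = 3 \<or> i = 4 \<or> i = 5" by (rule exhaust_5)
  have "fst (snd z) \<noteq> 0" using z by simp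
  with i show ?thesis
    unfolding tr
    by (elim disjE; simp only: G1_elt_rows;
        intro differentiable_scaleR differentiable_add differentiable_mult differentiable_divide
          differentiable_power differentiable_const bl row; simp)
qed

lemma triv_differentiable:
  assumes "z \<in> triv_dom U" "\<forall>p\<in>U. s differentiable (at p)"
  shows "triv s differentiable (at z)"
proof -
  have "(\<lambda>z. snd (triv s z)) differentiable (at z)"
  proof (subst differentiable_componentwise_within, intro ballI)
    fix e :: "real^5^5" assume "e \<in> Basis"
    then obtain i w where e: "e = axis i w" by (auto simp: Basis_vec_def)
    show "(\<lambda>z. snd (triv s z) \<bullet> e) differentiable (at z)"
      unfolding e inner_axis by (intro differentiable_inner triv_row_differentiable[OF assms] differentiable_const)
  qed
  moreover have "(\<lambda>z. fst (triv s z)) differentiable (at z)"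
    by (simp add: triv_def case_prod_beta)
      (intro bounded_linear_imp_differentiable bounded_linear_intros)
  ultimately have "(\<lambda>z. (fst (triv s z), snd (triv s z))) differentiable (at z)"
    by (intro differentiable_Pair)
  then show ?thesis by simp
qed

lemma inner_pullback:
  assumes "f differentiable (at x)"
  shows "pullback f \<omega> x \<bullet> v = \<omega> (f x) \<bullet> tmap f x v"
  using adjoint_works[OF linear_frechet_derivative[OF assms]]
  by (simp add: pullback_def inner_commute)

text \<open>The tautological forms have no component along the coframe directions, and
  \<open>triv s\<close> is the identity on the base component, so pulling back only evaluates the
  row at the image point.\<close>

lemma pullback_triv_row:
  assumes "z \<in> triv_dom U" "\<forall>p\<in>U. s differentiable (at p)"
  shows "pullback (triv s) (\<lambda>z. (snd z $ i, 0)) z = (snd (triv s z) $ i, 0)"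
proof -
  have d: "(triv s has_derivative tmap (triv s) z) (at z)"
    using triv_differentiable[OF assms] by (simp add: frechet_derivative_works)
  have "((\<lambda>z. fst (triv s z)) has_derivative (\<lambda>X. fst (tmap (triv s) z X))) (at z)"
    by (intro bounded_linear.has_derivative[OF bounded_linear_fst] d)
  moreover have "(\<lambda>z. fst (triv s z)) = fst" by (auto simp: triv_def)
  moreover have "((fst :: (real^5) \<times> real \<times> real \<times> real \<Rightarrow> _) has_derivative fst) (at z)"
    by (intro bounded_linear_imp_has_derivative bounded_linear_fst)
  ultimately have fst: "fst (tmap (triv s) z X) = fst X" for X
    using has_derivative_unique by metis
  have "pullback (triv s) (\<lambda>z. (snd z $ i, 0)) z \<bullet> X = (snd (triv s z) $ i, 0) \<bullet> X" for X
    unfolding inner_pullback[OF triv_differentiable[OF assms]] by (simp add: inner_prod_def fst)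
  then show ?thesis
    using vector_eq_rdot by blast
qed

lemma tmap_along_unit_section:
  fixes E :: "(real^5) \<times> real \<times> real \<times> real \<Rightarrow> 'b::real_normed_vector"
  assumes "E differentiable (at (p, 1, 1, 0))"
  shows "tmap E (p, 1, 1, 0) (v, 0) = tmap (\<lambda>y. E (y, 1, 1, 0)) p v"
proof -
  have "((\<lambda>y. (y, 1, 1, 0)) has_derivative (\<lambda>v. (v, 0, 0, 0))) (at p)"
    by (intro has_derivative_Pair has_derivative_ident has_derivative_const)
  from has_derivative_compose[OF this, of E] assms
  have "((\<lambda>y. E (y, 1, 1, 0)) has_derivative (\<lambda>v. tmap E (p, 1, 1, 0) (v, 0, 0, 0))) (at p)"
    by (simp add: frechet_derivative_works)
  then show ?thesis
    by (simp add: zero_prod_def frechet_derivative_at[symmetric])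
qed

text \<open>An instance of the naturality of d: vectors \<open>(v, 0)\<close> are tangent to the
  slice of parameters \<open>(1, 1, 0)\<close>, on which the trivialization is the section
  itself.\<close>

lemma ext_d_pullback_triv_row:
  assumes "open U" "p \<in> U" "\<forall>p\<in>U. s differentiable (at p)"
  shows "ext_d (pullback (triv s) (\<lambda>z. (snd z $ i, 0))) (p, 1, 1, 0) (v, 0) (u, 0)
      = ext_d (\<lambda>y. s y $ i) p v u"
proof -
  let ?z = "(p, 1, 1, 0) :: (real^5) \<times> real \<times> real \<times> real"
  let ?E = "\<lambda>z. (snd (triv s z) $ i, 0 :: real \<times> real \<times> real)"
  have z: "?z \<in> triv_dom U" using assms(2) by (simp add: triv_dom_def)
  have dE: "?E differentiable (at ?z)"
    by (intro differentiable_Pair triv_row_differentiable[OF z assms(3)] differentiable_const)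
  have "tmap (pullback (triv s) (\<lambda>z. (snd z $ i, 0))) ?z = tmap ?E ?z"
    by (rule frechet_derivative_transform_within_open[OF dE open_triv_dom[OF assms(1)] z, symmetric])
      (simp add: pullback_triv_row[OF _ assms(3)])
  moreover have "tmap ?E ?z (v, 0) = (tmap (\<lambda>y. s y $ i) p v, 0)" for v
  proof -
    have "(\<lambda>y. s y $ i) differentiable (at p)"
      using differentiable_row[OF bspec[OF assms(3) assms(2)]] .
    then have "((\<lambda>y. (s y $ i, 0 :: real \<times> real \<times> real)) has_derivative (\<lambda>v. (tmap (\<lambda>y. s y $ i) p v, 0))) (at p)"
      by (intro has_derivative_Pair has_derivative_const) (simp add: frechet_derivative_works)
    then show ?thesis
      unfolding tmap_along_unit_section[OF dE] by (simp add: triv_unit frechet_derivative_at[symmetric])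
  qed
  ultimately show ?thesis by (simp add: ext_d_def)
qed

section \<open>The structure equations pulled back by a section\<close>

lemma tmap_graph:
  assumes "s differentiable (at p)"
  shows "tmap (\<lambda>y. (y, s y)) p v = (v, tmap s p v)" "(\<lambda>y. (y, s y)) differentiable (at p)"
proof -
  have "((\<lambda>y. (y, s y)) has_derivative (\<lambda>v. (v, tmap s p v))) (at p)"
    using assms by (intro has_derivative_Pair has_derivative_ident) (simp add: frechet_derivative_works)
  then show "tmap (\<lambda>y. (y, s y)) p v = (v, tmap s p v)"
    by (metis frechet_derivative_at)
  show "(\<lambda>y. (y, s y)) differentiable (at p)"
    by (intro differentiable_Pair differentiable_ident assms)
qed

text \<open>The equations hold on the trivialization and are evaluated on vectors tangent to the
  slice of parameters \<open>(1, 1, 0)\<close>, which \<open>triv s\<close> maps to the graph of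
  \<open>s\<close>. Thus \<open>A \<omega>\<close> is the pullback of \<omega> to the base by
  \<open>s\<close>.\<close>

lemma structure_equations_along_section:
  assumes "fels_structure P D \<rho> L B \<alpha> \<beta> \<gamma> I T" "local_section P B U s" "p \<in> U"
  defines "A \<equiv> \<lambda>\<omega> v. \<omega> (p, s p) \<bullet> (v, tmap s p v)"
  shows "ext_d (\<lambda>y. sigma (s y)) p v u =
      A \<alpha> v * (sigma (s p) \<bullet> u) - A \<alpha> u * (sigma (s p) \<bullet> v)
      + (theta 0 (s p) \<bullet> v) * ((T 1 (p, s p) *\<^sub>R theta 1 (s p) + T 2 (p, s p) *\<^sub>R theta 2 (s p) + T 3 (p, s p) *\<^sub>R theta 3 (s p)) \<bullet> u)
      - (theta 0 (s p) \<bullet> u) * ((T 1 (p, s p) *\<^sub>R theta 1 (s p) + T 2 (p, s p) *\<^sub>R theta 2 (s p) + T 3 (p, s p) *\<^sub>R theta 3 (s p)) \<bullet> v)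
      + (theta 1 (s p) \<bullet> v) * ((T 4 (p, s p) *\<^sub>R theta 2 (s p) + T 5 (p, s p) *\<^sub>R theta 3 (s p)) \<bullet> u)
      - (theta 1 (s p) \<bullet> u) * ((T 4 (p, s p) *\<^sub>R theta 2 (s p) + T 5 (p, s p) *\<^sub>R theta 3 (s p)) \<bullet> v)" (is ?d\<sigma>)
    and "ext_d (\<lambda>y. theta 0 (s y)) p v u =
      A \<beta> v * (theta 0 (s p) \<bullet> u) - A \<beta> u * (theta 0 (s p) \<bullet> v)
      + (sigma (s p) \<bullet> v) * (theta 1 (s p) \<bullet> u) - (sigma (s p) \<bullet> u) * (theta 1 (s p) \<bullet> v)" (is ?d\<theta>0)
    and "ext_d (\<lambda>y. theta 1 (s y)) p v u =
      (A \<beta> v - A \<alpha> v) * (theta 1 (s p) \<bullet> u) - (A \<beta> u - A \<alpha> u) * (theta 1 (s p) \<bullet> v)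
      + A \<gamma> v * (theta 0 (s p) \<bullet> u) - A \<gamma> u * (theta 0 (s p) \<bullet> v)
      + (sigma (s p) \<bullet> v) * (theta 2 (s p) \<bullet> u) - (sigma (s p) \<bullet> u) * (theta 2 (s p) \<bullet> v)" (is ?d\<theta>1)
proof -
  let ?z = "(p, 1, 1, 0) :: (real^5) \<times> real \<times> real \<times> real"
  have U: "open U" and diff: "\<forall>p\<in>U. s differentiable (at p)"
    using assms(2) smooth_on_has_derivative unfolding local_section_def differentiable_def by blast+
  have z: "?z \<in> triv_dom U" using assms(3) by (simp add: triv_dom_def)
  have taut: "taut_sigma = (\<lambda>z. (snd z $ 1, 0))" "taut_theta 0 = (\<lambda>z. (snd z $ 2, 0))"
    "taut_theta 1 = (\<lambda>z. (snd z $ 3, 0))" "taut_theta 2 = (\<lambda>z. (snd z $ 4, 0))"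
    "taut_theta 3 = (\<lambda>z. (snd z $ 5, 0))"
    by (auto simp: taut_sigma_def taut_theta_def theta_simps sigma_def)
  have row: "pullback (triv s) (\<lambda>z. (snd z $ i, 0)) ?z = (s p $ i, 0)" for i
    using pullback_triv_row[OF z diff] by (simp add: triv_unit)
  have form: "pullback (triv s) \<omega> ?z \<bullet> (v, 0) = A \<omega> v" for \<omega> v
    unfolding inner_pullback[OF triv_differentiable[OF z diff]]
      tmap_along_unit_section[OF triv_differentiable[OF z diff]]
    by (simp add: triv_unit tmap_graph[OF bspec[OF diff assms(3)]] A_def)
  have eqs: "structure_equations (triv_dom U)
      (pullback (triv s) taut_sigma) (\<lambda>i. pullback (triv s) (taut_theta i))
      (pullback (triv s) \<alpha>) (pullback (triv s) \<beta>) (pullback (triv s) \<gamma>)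
      (\<lambda>i. I i \<circ> triv s) (\<lambda>i. T i \<circ> triv s)"
    using assms(1,2) unfolding fels_structure_def by blast
  note eqs = eqs[unfolded structure_equations_def taut, rule_format, OF z, of "(v, 0)" "(u, 0)",
      unfolded ext_d_pullback_triv_row[OF U assms(3) diff] row]
  show ?d\<sigma> ?d\<theta>0 ?d\<theta>1
    using eqs
    by (simp_all add: wedge_def inner_diff_left form triv_unit sigma_def theta_simps algebra_simps inner_add_left)
qed

text \<open>The curve \<open>(p + t *\<^sub>R v, s (p + t *\<^sub>R v))\<close> is the witness.
  Tangency matters because \<open>W_functions\<close> relates \<alpha> and \<beta> only on vectors
  tangent to the bundle.\<close>

lemma graph_tangent_vector:
  assumes "local_section P B U s" "p \<in> U"
  shows "(v, tmap s p v) \<in> tangent_vectors B (p, s p)"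
proof -
  have s: "open U" "smooth_on U s" "\<And>y. y \<in> U \<Longrightarrow> (y, s y) \<in> B"
    using assms(1) by (auto simp: local_section_def)
  define l where "l t = p + t *\<^sub>R v" for t :: real
  have dl: "(l has_derivative (\<lambda>r. r *\<^sub>R v)) (at t)" for t
    unfolding l_def by (auto intro!: derivative_eq_intros)
  have "continuous_on UNIV l"
    using dl by (meson continuous_at_imp_continuous_on has_derivative_continuous)
  then have "open (l -` U)" using s(1) by (simp add: continuous_on_open_vimage)
  moreover have "0 \<in> l -` U" using assms(2) by (simp add: l_def)
  ultimately obtain e where "e > 0" "ball 0 e \<subseteq> l -` U" using openE by blast
  then have e: "e > 0" "l ` {-e<..<e} \<subseteq> U" by (auto simp: subset_iff dist_real_def)
  have Cl: "Ck_on k {-e<..<e} l" for k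
    unfolding l_def
    by (intro Ck_on_add Ck_on_const Ck_on_linear[OF _ bounded_linear_scaleR_left])
      (auto intro: Ck_on_ident)
  have "Ck_on k {-e<..<e} (\<lambda>t. (l t, s (l t)))" for k
  proof -
    have "Ck_on k {-e<..<e} (\<lambda>t. s (l t))"
      by (rule Ck_on_compose[OF _ s(1) e(2) Cl]) (use s(2) in \<open>auto simp: smooth_on_def\<close>)
    then have "Ck_on k {-e<..<e} (\<lambda>t. (l t, 0) + (0, s (l t)))"
      by (intro Ck_on_add Ck_on_linear[of _ "\<lambda>x. (x, 0)", OF _ _ Cl] Ck_on_linear[of _ "\<lambda>x. (0, x)"] bounded_linear_intros) auto
    then show ?thesis by simp
  qed
  moreover have "((\<lambda>t. (l t, s (l t))) has_vector_derivative (v, tmap s p v)) (at 0)"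
  proof -
    have "(s has_derivative tmap s p) (at (l 0))"
      using smooth_on_has_derivative[OF s(2) assms(2)] by (simp add: l_def)
    from has_derivative_Pair[OF dl has_derivative_compose[OF dl this]] show ?thesis
      using linear_scale[OF has_derivative_linear[OF smooth_on_has_derivative[OF s(2) assms(2)]]]
      by (simp add: has_vector_derivative_def)
  qed
  moreover have "(l t, s (l t)) \<in> B" if "t \<in> {-e<..<e}" for t
    using e(2) s(3) that by blast
  ultimately show ?thesis
    unfolding tangent_vectors_def smooth_on_def
    using e(1) by (auto intro!: exI[of _ e] exI[of _ "\<lambda>t. (l t, s (l t))"] simp: l_def)
qed

section \<open>Metrics on the contact planes\<close>

lemma invertible_row_values:
  fixes A :: "real^'n^'n"
  assumes "invertible A"
  obtains u where "\<And>i. A $ i \<bullet> u = y $ i"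
proof -
  obtain A' where "A ** A' = mat 1" using assms by (auto simp: invertible_def)
  then have "(A *v (A' *v y)) $ i = y $ i" for i
    by (simp add: matrix_vector_mul_assoc)
  then show ?thesis
    using that[of "A' *v y"] by (simp add: matrix_vector_mul_component)
qed

lemma coframe_values:
  assumes "invertible (u :: real^5^5)"
  obtains x where "sigma u \<bullet> x = a" "theta 0 u \<bullet> x = b" "theta 1 u \<bullet> x = c" "theta 2 u \<bullet> x = d"
proof -
  obtain x where "\<And>i. u $ i \<bullet> x = (\<chi> i. if i = 1 then a else if i = 2 then b else if i = 3 then c else d) $ i"
    using invertible_row_values[OF assms] by blast
  then show ?thesis
    by (intro that[of x]) (simp_all add: sigma_def theta_simps)
qed

section \<open>Descent of the metric, separated from the coframe bundle\<close>

text \<open>The last three hypotheses are the structure equations contracted with a vertical vector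
  and taken modulo \<open>\<theta>\<^sub>0\<close>, with \<open>w\<close> in the place of
  \<open>W\<^sub>2\<close>. The proof studies the metric on fixed vectors of \<open>M\<close> as a
  function along a fibre.\<close>

lemma well_defined_contact_metric_iff:
  fixes w :: "real^5 \<Rightarrow> real"
  assumes fib: "fibration P M \<rho>" and s: "smooth_on P s"
    and inv: "\<And>p. p \<in> P \<Longrightarrow> invertible (s p)"
    and D: "\<And>p v. p \<in> P \<Longrightarrow> tmap \<rho> p v \<in> D (\<rho> p) \<longleftrightarrow> theta 0 (s p) \<bullet> v = 0"
    and ker: "\<And>p v. p \<in> P \<Longrightarrow> tmap \<rho> p v = 0 \<Longrightarrow> theta 0 (s p) \<bullet> v = 0 \<and> theta 1 (s p) \<bullet> v = 0"
    and d\<theta>0: "\<And>p v u. p \<in> P \<Longrightarrow> tmap \<rho> p v = 0 \<Longrightarrow> theta 0 (s p) \<bullet> u = 0 \<Longrightarrow>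
      ext_d (\<lambda>y. theta 0 (s y)) p v u = (sigma (s p) \<bullet> v) * (theta 1 (s p) \<bullet> u)"
    and d\<sigma>: "\<And>p v u. p \<in> P \<Longrightarrow> tmap \<rho> p v = 0 \<Longrightarrow> sigma (s p) \<bullet> v = 0 \<Longrightarrow> theta 0 (s p) \<bullet> u = 0 \<Longrightarrow>
      ext_d (\<lambda>y. sigma (s y)) p v u =
        (theta 2 (s p) \<bullet> v) * (theta 1 (s p) \<bullet> u - 2 * w p * (sigma (s p) \<bullet> u))"
    and d\<theta>1: "\<And>p v u. p \<in> P \<Longrightarrow> tmap \<rho> p v = 0 \<Longrightarrow> sigma (s p) \<bullet> v = 0 \<Longrightarrow> theta 0 (s p) \<bullet> u = 0 \<Longrightarrow>
      ext_d (\<lambda>y. theta 1 (s y)) p v u =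
        - (theta 2 (s p) \<bullet> v) * (sigma (s p) \<bullet> u + w p * (theta 1 (s p) \<bullet> u))"
  shows "well_defined_contact_metric P M D \<rho> s (g_metric s) \<longleftrightarrow> (\<forall>p\<in>P. w p = 0)"
proof -
  have P: "open P" "smooth_on P \<rho>" "\<rho> ` P = M" "\<And>p. p \<in> P \<Longrightarrow> surj (tmap \<rho> p)"
    "\<And>q. q \<in> M \<Longrightarrow> connected {p \<in> P. \<rho> p = q}"
    using fib by (auto simp: fibration_def)
  have row: "smooth_on P (\<lambda>p. s p $ i)" for i
    using s Ck_on_linear[OF P(1) bounded_linear_vec_nth] by (auto simp: smooth_on_def)
  have rows: "smooth_on P (\<lambda>p. sigma (s p))" "smooth_on P (\<lambda>p. theta i (s p))" for i
    using row by (simp_all add: sigma_def theta_def)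

  obtain b0 where b0: "smooth_on P b0" "\<And>p u. p \<in> P \<Longrightarrow> theta 0 (s p) \<bullet> u = b0 p \<bullet> tmap \<rho> p u"
    using form_factors_through_submersion[OF P(1,2,4) rows(2)] ker by metis
  \<comment> \<open>The kernel of \<open>b0 p\<close> depends only on \<open>\<rho> p\<close>,
    although \<open>b0 p\<close> itself may be rescaled along the fibre.\<close>
  have D_iff: "x \<in> D (\<rho> p) \<longleftrightarrow> b0 p \<bullet> x = 0" if "p \<in> P" for p x
    using D[OF that] b0(2)[OF that] surjD[OF P(4)[OF that], of x] by metis

  have ker_\<sigma>: "sigma (s p) \<bullet> v = 0" if p: "p \<in> P" and v: "tmap \<rho> p v = 0" for p v
  proof -
    obtain u where u: "theta 0 (s p) \<bullet> u = 0" "theta 1 (s p) \<bullet> u = 1"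
      using coframe_values[OF inv[OF p]] by metis
    \<comment> \<open>The contact vector \<open>tmap \<rho> p u\<close> is held fixed while
      \<open>y\<close> moves. Along the fibre \<open>b0 y\<close> annihilates it, so the vertical
      derivative is zero; by \<open>d\<theta>0\<close> and the choice of \<open>u\<close> this
      derivative is \<open>sigma (s p) \<bullet> v\<close>.\<close>
    have "((\<lambda>y. b0 y \<bullet> tmap \<rho> p u) has_derivative (\<lambda>v. tmap b0 p v \<bullet> tmap \<rho> p u)) (at p)"
      by (intro has_derivative_inner_left smooth_on_has_derivative[OF b0(1) p])
    moreover have "b0 y \<bullet> tmap \<rho> p u = b0 p \<bullet> tmap \<rho> p u" if "y \<in> P" "\<rho> y = \<rho> p" for y
    proof -
      have "tmap \<rho> p u \<in> D (\<rho> p)" using D[OF p] u by simp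
      then show ?thesis using D_iff[OF p] D_iff[OF that(1)] that(2) by metis
    qed
    ultimately have "tmap b0 p v \<bullet> tmap \<rho> p u = 0"
      by (rule derivative_zero_if_constant_on_fibre[OF P(1,2) p P(4)[OF p] _ _ v])
    then show ?thesis
      using d\<theta>0[OF p v u(1)] ext_d_factored_form[OF P(1,2) rows(2) b0(1,2) p v, of u] u(2) by simp
  qed

  obtain b where b: "smooth_on P b" "\<And>p u. p \<in> P \<Longrightarrow> sigma (s p) \<bullet> u = b p \<bullet> tmap \<rho> p u"
    using form_factors_through_submersion[OF P(1,2,4) rows(1)] ker_\<sigma> by metis
  obtain b1 where b1: "smooth_on P b1" "\<And>p u. p \<in> P \<Longrightarrow> theta 1 (s p) \<bullet> u = b1 p \<bullet> tmap \<rho> p u"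
    using form_factors_through_submersion[OF P(1,2,4) rows(2)] ker by metis

  \<comment> \<open>The covectors \<open>b p\<close>, \<open>b0 p\<close>, \<open>b1 p\<close> form
    a basis: values of the coframe can be prescribed, so the matrix with these rows is surjective,
    hence injective.\<close>
  have zero: "x = 0" if p: "p \<in> P" and x: "b p \<bullet> x = 0" "b0 p \<bullet> x = 0" "b1 p \<bullet> x = 0" for p x
  proof -
    define B :: "real^3^3" where "B = (\<chi> i. if i = 1 then b p else if i = 2 then b0 p else b1 p)"
    have B: "B *v x = y \<longleftrightarrow> b p \<bullet> x = y $ 1 \<and> b0 p \<bullet> x = y $ 2 \<and> b1 p \<bullet> x = y $ 3" for x y
      by (simp add: vec_eq_iff matrix_vector_mul_component B_def forall_3)
    have "surj ((*v) B)"
      unfolding surj_def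
    proof
      fix y :: "real^3"
      obtain u where "sigma (s p) \<bullet> u = y $ 1" "theta 0 (s p) \<bullet> u = y $ 2" "theta 1 (s p) \<bullet> u = y $ 3"
        using coframe_values[OF inv[OF p]] by metis
      then show "\<exists>x. y = B *v x" using B b(2) b0(2) b1(2) p by metis
    qed
    then have "inj ((*v) B)"
      using linear_surjective_imp_injective matrix_vector_mul_linear by blast
    moreover have "B *v x = B *v 0" using B x by simp
    ultimately show ?thesis by (rule injD)
  qed

  define \<phi> where "\<phi> x y p = (b p \<bullet> x) * (b p \<bullet> y) + (b1 p \<bullet> x) * (b1 p \<bullet> y)" for x y p
  have g: "g_metric s p u v = \<phi> (tmap \<rho> p u) (tmap \<rho> p v) p" if "p \<in> P" for p u v
    using that by (simp add: g_metric_def \<phi>_def b(2) b1(2) del: One_nat_def)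
  have d\<phi>: "(\<phi> x y has_derivative (\<lambda>v. (b p \<bullet> x) * (tmap b p v \<bullet> y) + (tmap b p v \<bullet> x) * (b p \<bullet> y)
      + ((b1 p \<bullet> x) * (tmap b1 p v \<bullet> y) + (tmap b1 p v \<bullet> x) * (b1 p \<bullet> y)))) (at p)" if "p \<in> P" for p x y
    unfolding \<phi>_def
    by (intro has_derivative_add has_derivative_mult has_derivative_inner_left
        smooth_on_has_derivative[OF b(1) that] smooth_on_has_derivative[OF b1(1) that])
  have vert: "tmap b p v \<bullet> x = (theta 2 (s p) \<bullet> v) * (b1 p \<bullet> x - 2 * w p * (b p \<bullet> x))"
    "tmap b1 p v \<bullet> x = - (theta 2 (s p) \<bullet> v) * (b p \<bullet> x + w p * (b1 p \<bullet> x))"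
    if p: "p \<in> P" and v: "tmap \<rho> p v = 0" and x: "x \<in> D (\<rho> p)" for p v x
  proof -
    obtain u where u: "x = tmap \<rho> p u" using P(4)[OF p] by (metis surjD)
    then have u0: "theta 0 (s p) \<bullet> u = 0" using D[OF p] x by simp
    show "tmap b p v \<bullet> x = (theta 2 (s p) \<bullet> v) * (b1 p \<bullet> x - 2 * w p * (b p \<bullet> x))"
      using d\<sigma>[OF p v ker_\<sigma>[OF p v] u0] ext_d_factored_form[OF P(1,2) rows(1) b(1,2) p v, of u]
      by (simp add: u b(2)[OF p] b1(2)[OF p] del: One_nat_def)
    show "tmap b1 p v \<bullet> x = - (theta 2 (s p) \<bullet> v) * (b p \<bullet> x + w p * (b1 p \<bullet> x))"
      using d\<theta>1[OF p v ker_\<sigma>[OF p v] u0] ext_d_factored_form[OF P(1,2) rows(2) b1(1,2) p v, of u]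
      by (simp add: u b(2)[OF p] b1(2)[OF p] del: One_nat_def)
  qed

  show ?thesis
  proof
    assume "well_defined_contact_metric P M D \<rho> s (g_metric s)"
    then obtain h where h: "\<And>p u v. p \<in> P \<Longrightarrow> theta 0 (s p) \<bullet> u = 0 \<Longrightarrow> theta 0 (s p) \<bullet> v = 0 \<Longrightarrow>
        g_metric s p u v = h (\<rho> p) (tmap \<rho> p u) (tmap \<rho> p v)"
      unfolding well_defined_contact_metric_def by blast
    have h\<phi>: "\<phi> x x p = h (\<rho> p) x x" if p: "p \<in> P" and x: "x \<in> D (\<rho> p)" for p x
    proof -
      obtain u where u: "x = tmap \<rho> p u" using P(4)[OF p] by (metis surjD)
      then have "theta 0 (s p) \<bullet> u = 0" using D[OF p] x by simp
      then show ?thesis using h[OF p, of u u] g[OF p] u by simp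
    qed
    show "\<forall>p\<in>P. w p = 0"
    proof
      fix p assume p: "p \<in> P"
      \<comment> \<open>Test vectors: \<open>u\<close> projects to a contact vector of
        \<open>g\<close>-length 1 on which \<open>\<theta>\<^sub>1\<close> vanishes, and
        \<open>v\<close> is vertical with \<open>\<theta>\<^sub>2\<close> equal to 1. The derivative
        of \<open>\<phi> x x\<close> along \<open>v\<close> is then \<open>-4 * w p\<close>.\<close>
      obtain u where u: "sigma (s p) \<bullet> u = 1" "theta 0 (s p) \<bullet> u = 0" "theta 1 (s p) \<bullet> u = 0"
        using coframe_values[OF inv[OF p]] by metis
      obtain v where v: "sigma (s p) \<bullet> v = 0" "theta 0 (s p) \<bullet> v = 0" "theta 1 (s p) \<bullet> v = 0" "theta 2 (s p) \<bullet> v = 1"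
        using coframe_values[OF inv[OF p]] by metis
      have v0: "tmap \<rho> p v = 0"
        using zero[OF p] v b(2)[OF p] b0(2)[OF p] b1(2)[OF p] by (simp del: One_nat_def)
      define x where "x = tmap \<rho> p u"
      have x: "x \<in> D (\<rho> p)" "b p \<bullet> x = 1" "b1 p \<bullet> x = 0"
        using D[OF p] u b(2)[OF p] b1(2)[OF p] by (simp_all add: x_def del: One_nat_def)
      have "\<phi> x x y = \<phi> x x p" if "y \<in> P" "\<rho> y = \<rho> p" for y
        using h\<phi>[OF p x(1)] h\<phi>[OF that(1), of x] that(2) x(1) by simp
      from derivative_zero_if_constant_on_fibre[OF P(1,2) p P(4)[OF p] d\<phi>[OF p] this v0]
      show "w p = 0"
        using vert(1)[OF p v0 x(1)] x(2,3) v(4) by simp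
    qed
  next
    assume w: "\<forall>p\<in>P. w p = 0"
    have const: "\<phi> x y p = \<phi> x y p'"
      if p: "p \<in> P" "p' \<in> P" "\<rho> p = \<rho> p'" and xy: "x \<in> D (\<rho> p)" "y \<in> D (\<rho> p)" for p p' x y
    proof (rule constant_on_connected_fibre[OF P(1,2,4)])
      show "connected {z \<in> P. \<rho> z = \<rho> p}" using P(3,5) p(1) by blast
      show "(\<phi> x y has_derivative (\<lambda>v. (b z \<bullet> x) * (tmap b z v \<bullet> y) + (tmap b z v \<bullet> x) * (b z \<bullet> y)
        + ((b1 z \<bullet> x) * (tmap b1 z v \<bullet> y) + (tmap b1 z v \<bullet> x) * (b1 z \<bullet> y)))) (at z)" if "z \<in> P" for z
        by (rule d\<phi>[OF that])
      \<comment> \<open>For \<open>w = 0\<close>, \<open>vert\<close> says that on \<open>D\<close>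
        the pair \<open>(b, b1)\<close> moves along the fibre by an infinitesimal rotation, which
        preserves the sum of squares and its polarization.\<close>
      show "(b z \<bullet> x) * (tmap b z v \<bullet> y) + (tmap b z v \<bullet> x) * (b z \<bullet> y)
        + ((b1 z \<bullet> x) * (tmap b1 z v \<bullet> y) + (tmap b1 z v \<bullet> x) * (b1 z \<bullet> y)) = 0"
        if "z \<in> P" "\<rho> z = \<rho> p" "tmap \<rho> z v = 0" for z v
        using xy w that vert[OF that(1,3), of x] vert[OF that(1,3), of y] by (simp add: algebra_simps)
    qed (use p in auto)
    \<comment> \<open>Any point of the fibre serves, since by \<open>const\<close> the value on
      contact vectors does not depend on the choice.\<close>
    define c where "c q = (SOME p. p \<in> P \<and> \<rho> p = q)" for q
    have c: "c q \<in> P" "\<rho> (c q) = q" if "q \<in> M" for q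
      using someI_ex[of "\<lambda>p. p \<in> P \<and> \<rho> p = q"] that P(3) by (auto simp: c_def)
    define h where "h q x y = \<phi> x y (c q)" for q x y
    have h: "h (\<rho> p) x y = \<phi> x y p" if "p \<in> P" "x \<in> D (\<rho> p)" "y \<in> D (\<rho> p)" for p x y
    proof -
      have "\<rho> p \<in> M" using that(1) P(3) by blast
      then show ?thesis
        unfolding h_def using const[OF that(1) c(1) _ that(2,3), of "\<rho> p"] c(2) by simp
    qed
    have "contact_metric M D h"
      unfolding contact_metric_def
    proof (intro conjI ballI allI impI)
      fix q assume q: "q \<in> M"
      show "bilinear (h q)"
        unfolding bilinear_def h_def \<phi>_def
        by (auto intro!: linearI simp: inner_add_right algebra_simps)
      show "h q x y = h q y x" for x y by (simp add: h_def \<phi>_def mult.commute)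
      show "h q x x > 0" if x: "x \<in> D q" "x \<noteq> 0" for x
      proof -
        \<comment> \<open>A contact vector is annihilated by \<open>b0\<close>, so if
          \<open>b\<close> and \<open>b1\<close> also annihilated it, it would vanish by
          \<open>zero\<close>.\<close>
        have "b (c q) \<bullet> x \<noteq> 0 \<or> b1 (c q) \<bullet> x \<noteq> 0"
          using zero[OF c(1)[OF q], of x] x D_iff[OF c(1)[OF q], of x] c(2)[OF q] by auto
        then show ?thesis
          unfolding h_def \<phi>_def power2_eq_square[symmetric] by (simp add: sum_power2_gt_zero_iff)
      qed
    next
      fix U X Y
      assume U: "open U \<and> U \<subseteq> M \<and> smooth_on U X \<and> smooth_on U Y \<and> (\<forall>y\<in>U. X y \<in> D y \<and> Y y \<in> D y)"
      let ?W = "{p \<in> P. \<rho> p \<in> U}"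
      have "continuous_on P \<rho>"
        using P(2) unfolding smooth_on_def by (metis Ck_on.simps(1))
      then have W: "open ?W"
        using continuous_open_preimage[of P \<rho> U] P(1) U by (simp add: vimage_def Int_def)
      have CW: "Ck_on k ?W f" if "smooth_on P f" for k and f :: "real^5 \<Rightarrow> real^3"
        using that by (auto simp: smooth_on_def intro: Ck_on_subset)
      have C\<rho>: "Ck_on k ?W (\<lambda>p. Z (\<rho> p))" if "smooth_on U Z" for k and Z :: "real^3 \<Rightarrow> real^3"
        by (rule Ck_on_compose[OF W _ _ CW[OF P(2)]]) (use U that in \<open>auto simp: smooth_on_def\<close>)
      \<comment> \<open>The choice \<open>c\<close> gives no regularity on \<open>M\<close>.
        Smoothness is checked upstairs, where \<open>h\<close> is given by the smooth maps
        \<open>b\<close> and \<open>b1\<close>, and then descends along the submersion.\<close>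
      have "Ck_on k ?W (\<lambda>p. \<phi> (X (\<rho> p)) (Y (\<rho> p)) p)" for k
        unfolding \<phi>_def using U
        by (intro Ck_on_add[OF W] Ck_on_mult[OF W] Ck_on_inner[OF W] CW b(1) b1(1) C\<rho>) auto
      then have "Ck_on k ?W (\<lambda>p. h (\<rho> p) (X (\<rho> p)) (Y (\<rho> p)))" for k
        by (rule Ck_on_cong[OF W, rotated]) (use U h in auto)
      then show "smooth_on U (\<lambda>y. h y (X y) (Y y))"
        unfolding smooth_on_def using U P(3)
        by (auto intro!: Ck_on_descend[OF P(1,2,4), where f = "\<lambda>y. h y (X y) (Y y)"])
    qed
    moreover have "g_metric s p u v = h (\<rho> p) (tmap \<rho> p u) (tmap \<rho> p v)"
      if "p \<in> P" "theta 0 (s p) \<bullet> u = 0" "theta 0 (s p) \<bullet> v = 0" for p u v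
      using that D[OF that(1)] h[OF that(1)] g[OF that(1)] by simp
    ultimately show "well_defined_contact_metric P M D \<rho> s (g_metric s)"
      unfolding well_defined_contact_metric_def by blast
  qed
qed

section \<open>Connection forms of a canonical coframe on vertical vectors\<close>

theorem proposition2p4:
  fixes P :: "(real^5) set" and M :: "(real^3) set"
    and D :: "real^3 \<Rightarrow> (real^3) set" and \<rho> :: "real^5 \<Rightarrow> real^3" and L :: "real^5 \<Rightarrow> (real^5) set"
    and B1 :: "cfb set"
    and \<alpha> \<beta> \<gamma> :: "cfb \<Rightarrow> cfb"
    and I T W :: "nat \<Rightarrow> cfb \<Rightarrow> real"
    and s :: "real^5 \<Rightarrow> real^5^5"
  assumes "contact_path_geometry P M D \<rho> L"
    and "fels_structure P D \<rho> L B1 \<alpha> \<beta> \<gamma> I T"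
    and "definite_variational B1 I T"
    and "W_functions P (B2 B1 T) \<alpha> \<beta> W"
    and "canonical_coframe P (B2 B1 T) \<alpha> \<beta> s"
  shows "well_defined_contact_metric P M D \<rho> s (g_metric s) \<longleftrightarrow> (\<forall>p\<in>P. W 2 (p, s p) = 0)"
proof -
  have sec2: "local_section P (B2 B1 T) P s"
    using assms(5) by (simp add: canonical_coframe_def)
  then have sec: "local_section P B1 P s"
    by (auto simp: local_section_def B2_def)
  have s: "smooth_on P s" using sec by (simp add: local_section_def)
  have fib: "fibration P M \<rho>" using assms(1) by (simp add: contact_path_geometry_def)
  have T: "T 2 (p, s p) = 0" "T 4 (p, s p) = -1" "T 5 (p, s p) = 0" if "p \<in> P" for p
    using sec2 assms(3) that
    by (auto simp: local_section_def B2_def definite_variational_def variational_def)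
  have ad: "invertible (s p) \<and> (\<forall>v. tmap \<rho> p v \<in> D (\<rho> p) \<longleftrightarrow> theta 0 (s p) \<bullet> v = 0)
      \<and> sysI \<rho> L p = span {theta 0 (s p), theta 1 (s p)}" if "p \<in> P" for p
  proof -
    \<comment> \<open>Membership in \<open>B0\<close> supplies some adapted section with the value
      \<open>s p\<close> at \<open>p\<close>; the conditions extracted here involve only that
      value.\<close>
    have "(p, s p) \<in> B0 P D \<rho> L"
      using sec assms(2) that by (auto simp: local_section_def fels_structure_def)
    then show ?thesis
      unfolding B0_def zero_adapted_def by fastforce
  qed
  have ker: "theta 0 (s p) \<bullet> v = 0 \<and> theta 1 (s p) \<bullet> v = 0" if p: "p \<in> P" and v: "tmap \<rho> p v = 0" for p v
  proof -
    have "{theta 0 (s p), theta 1 (s p)} \<subseteq> sysI \<rho> L p"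
      using ad[OF p] span_superset by metis
    then show ?thesis
      using v by (auto simp: sysI_def annihilator_def fibre_tangent_def)
  qed
  have conn: "\<alpha> (p, s p) \<bullet> (v, tmap s p v) = -2 * W 2 (p, s p) * (theta 2 (s p) \<bullet> v)"
    "\<beta> (p, s p) \<bullet> (v, tmap s p v) = -3 * W 2 (p, s p) * (theta 2 (s p) \<bullet> v)"
    if p: "p \<in> P" and v: "tmap \<rho> p v = 0" for p v
  proof -
    have ds: "s differentiable (at p)"
      using smooth_on_has_derivative[OF s p] by (auto simp: differentiable_def)
    have "pullback (\<lambda>y. (y, s y)) (\<lambda>z. 3 *\<^sub>R \<alpha> z - 2 *\<^sub>R \<beta> z) p \<bullet> v = 0"
      using assms(5) p by (simp add: canonical_coframe_def)
    then have 1: "3 * (\<alpha> (p, s p) \<bullet> (v, tmap s p v)) = 2 * (\<beta> (p, s p) \<bullet> (v, tmap s p v))"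
      by (simp add: inner_pullback[OF tmap_graph(2)[OF ds]] tmap_graph(1)[OF ds] inner_diff_left)
    have "(p, s p) \<in> B2 B1 T" using sec2 p by (simp add: local_section_def)
    then have "\<beta> (p, s p) \<bullet> (v, tmap s p v) =
        (2 *\<^sub>R \<alpha> (p, s p) + (\<Sum>i\<le>2. W i (p, s p) *\<^sub>R taut_theta i (p, s p))) \<bullet> (v, tmap s p v)"
      using assms(4) graph_tangent_vector[OF sec2 p] unfolding W_functions_def by blast
    then have "\<beta> (p, s p) \<bullet> (v, tmap s p v) =
        2 * (\<alpha> (p, s p) \<bullet> (v, tmap s p v)) + W 2 (p, s p) * (theta 2 (s p) \<bullet> v)"
      using ker[OF p v] by (simp add: eval_nat_numeral inner_add_left taut_theta_def)
    \<comment> \<open>On vertical vectors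
      \<open>\<beta> = 2\<alpha> + W\<^sub>2\<theta>\<^sub>2\<close> and
      \<open>3\<alpha> = 2\<beta>\<close>. Eliminating \<beta> gives
      \<open>3\<alpha> = 4\<alpha> + 2W\<^sub>2\<theta>\<^sub>2\<close>, whence the factors -2 and
      -3.\<close>
    with 1 show "\<alpha> (p, s p) \<bullet> (v, tmap s p v) = -2 * W 2 (p, s p) * (theta 2 (s p) \<bullet> v)"
      "\<beta> (p, s p) \<bullet> (v, tmap s p v) = -3 * W 2 (p, s p) * (theta 2 (s p) \<bullet> v)"
      unfolding mult.assoc by linarith+
  qed
  note str = structure_equations_along_section[OF assms(2) sec]
  show ?thesis
  proof (rule well_defined_contact_metric_iff[OF fib s])
    fix p v u assume p: "p \<in> P"
    show "invertible (s p)" "tmap \<rho> p v \<in> D (\<rho> p) \<longleftrightarrow> theta 0 (s p) \<bullet> v = 0"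
      using ad[OF p] by auto
    assume v: "tmap \<rho> p v = 0"
    show "theta 0 (s p) \<bullet> v = 0 \<and> theta 1 (s p) \<bullet> v = 0" by (rule ker[OF p v])
    note * = ker[OF p v] conn[OF p v] T[OF p]
    assume u: "theta 0 (s p) \<bullet> u = 0"
    show "ext_d (\<lambda>y. theta 0 (s y)) p v u = (sigma (s p) \<bullet> v) * (theta 1 (s p) \<bullet> u)"
      using * u by (simp add: str(2)[OF p])
    assume "sigma (s p) \<bullet> v = 0"
    \<comment> \<open>In d\<sigma> the value \<open>T 4 = -1\<close> turns the last term into
      \<open>+\<theta>\<^sub>2(v)\<theta>\<^sub>1(u)\<close>, and \<alpha> contributes the factor
      -2. In \<open>d\<theta>\<^sub>1\<close> the coefficient is
      \<open>\<beta> - \<alpha> = -W\<^sub>2\<theta>\<^sub>2\<close>, while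
      \<open>\<sigma> \<and> \<theta>\<^sub>2\<close> contributes
      \<open>-\<theta>\<^sub>2(v)\<sigma>(u)\<close>.\<close>
    with * u show "ext_d (\<lambda>y. sigma (s y)) p v u =
        (theta 2 (s p) \<bullet> v) * (theta 1 (s p) \<bullet> u - 2 * W 2 (p, s p) * (sigma (s p) \<bullet> u))"
      "ext_d (\<lambda>y. theta 1 (s y)) p v u =
        - (theta 2 (s p) \<bullet> v) * (sigma (s p) \<bullet> u + W 2 (p, s p) * (theta 1 (s p) \<bullet> u))"
      by (simp_all add: str(1,3)[OF p] inner_add_left algebra_simps del: One_nat_def)
  qed
qed

end
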